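(* Assume Model M with draw probability $p=0$ or $p\in[1/3,1)$. Fix $t\in\mathbb{R}$ and define $S_n=\sum_{j=1}^n \mathbf{1}\{s_j^*>x_n(t)\}$. Then for every fixed integer $k\ge 0$, $$\lim_{n\to\infty}P(S_n=k)=e^{-\lambda(t)}\frac{\lambda(t)^k}{k!},\qquad \lambda(t)=e^{-t}.$$
   Context: Model M (round-robin tournament with $n$ players): for each ordered pair $i\neq j$ in $\{1,\dots,n\}$, $X_{ij}\in\{0,1/2,1\}$ is the score of player $i$ in the game against player $j$, with $X_{ij}+X_{ji}=1$; $P(X_{ij}=1/2)=p$ for all games and $P(X_{ij}=1)=P(X_{ji}=1)=(1-p)/2$; the $\binom{n}{2}$ pairs $(X_{ij},X_{ji})$, $i<j$, are mutually independent. The score of player $i$ is $s_i=\sum_{j\neq i}X_{ij}$, with $E(s_i)=(n-1)/2$ and standard deviation $\sigma_n=\sqrt{(n-1)(1-p)/4}$. The normalized score is $s_i^*=(s_i-(n-1)/2)/\sigma_n$. Set $a_n=(2\log n)^{-1/2}$, $b_n=(2\log n)^{1/2}-\tfrac12(2\log n)^{-1/2}(\log\log n+\log 4\pi)$, and $x_n(t)=a_nt+b_n$. *)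

theory Defs
  imports "HOL-Probability.Probability"
begin

text \<open>Model M. One game between players i < j: the value is the score X_ij of player i;
  X_ji = 1 - X_ij. Draw (1/2) with probability p, otherwise a win (1) or loss (0)
  each with probability (1-p)/2.\<close>
definition game_pmf :: "real \<Rightarrow> real pmf" where
  "game_pmf p = bind_pmf (bernoulli_pmf p)
     (\<lambda>d. if d then return_pmf (1/2)
          else map_pmf (\<lambda>b. if b then 1 else 0) (bernoulli_pmf (1/2)))"

definition pairs :: "nat \<Rightarrow> (nat \<times> nat) set" where
  "pairs n = {(i, j). 1 \<le> i \<and> i < j \<and> j \<le> n}"

definition tournament :: "nat \<Rightarrow> real \<Rightarrow> (nat \<times> nat \<Rightarrow> real) pmf" where
  "tournament n p = Pi_pmf (pairs n) 0 (\<lambda>_. game_pmf p)"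

definition X :: "(nat \<times> nat \<Rightarrow> real) \<Rightarrow> nat \<Rightarrow> nat \<Rightarrow> real" where
  "X \<omega> i j = (if i < j then \<omega> (i, j) else 1 - \<omega> (j, i))"

definition score :: "nat \<Rightarrow> (nat \<times> nat \<Rightarrow> real) \<Rightarrow> nat \<Rightarrow> real" where
  "score n \<omega> i = (\<Sum>j\<in>{1..n} - {i}. X \<omega> i j)"

definition sigma_n :: "nat \<Rightarrow> real \<Rightarrow> real" where
  "sigma_n n p = sqrt ((real n - 1) * (1 - p) / 4)"

definition norm_score :: "nat \<Rightarrow> real \<Rightarrow> (nat \<times> nat \<Rightarrow> real) \<Rightarrow> nat \<Rightarrow> real" where
  "norm_score n p \<omega> i = (score n \<omega> i - (real n - 1) / 2) / sigma_n n p"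

definition a_n :: "nat \<Rightarrow> real" where
  "a_n n = 1 / sqrt (2 * ln (real n))"

definition b_n :: "nat \<Rightarrow> real" where
  "b_n n = sqrt (2 * ln (real n))
           - (1/2) * (1 / sqrt (2 * ln (real n))) * (ln (ln (real n)) + ln (4 * pi))"

definition x_n :: "nat \<Rightarrow> real \<Rightarrow> real" where
  "x_n n t = a_n n * t + b_n n"

definition S_n :: "nat \<Rightarrow> real \<Rightarrow> real \<Rightarrow> (nat \<times> nat \<Rightarrow> real) \<Rightarrow> nat" where
  "S_n n p t \<omega> = card {j\<in>{1..n}. norm_score n p \<omega> j > x_n n t}"

end

theory Submission
  imports Defs "HOL-Real_Asymp.Real_Asymp"
begin

text \<open>
  Method of moments: it suffices that \<open>E (S_n choose m) \<rightarrow> exp (- t) ^ m / m!\<close> for every \<open>m\<close>.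
  This expectation is a sum over \<open>m\<close>-sets \<open>J\<close> of players of the probability that all of \<open>J\<close>
  exceed the threshold. The scores of \<open>J\<close> against the other players are independent, and the
  games inside \<open>J\<close> shift each score by at most \<open>m\<close>, which is negligible; so the moment limit
  follows from the one-player asymptotics \<open>P (s > threshold + c) \<sim> exp (- t) / n\<close>
  for every constant \<open>c\<close>.

  Given the number \<open>D\<close> of decisive games, a score is \<open>(N - D) / 2\<close> plus a symmetric binomial
  variable with \<open>D\<close> trials, and \<open>D\<close> is concentrated by Hoeffding's inequality. Stirling's
  formula and a comparison of the binomial tail with geometric series give
  \<open>P (Bin (M, 1/2) > M/2 + y sqrt M / 2) \<sim> exp (- y\<^sup>2 / 2) / (y sqrt (2 \<pi>))\<close> for
  \<open>y \<rightarrow> \<infinity>\<close>, \<open>y ^ 4 / M \<rightarrow> 0\<close>, which covers \<open>y \<sim> sqrt (2 ln n)\<close>.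
\<close>

section \<open>Stirling's formula\<close>

text \<open>For positive \<open>n\<close> this is the logarithm of
  \<open>n! / (sqrt n * (n / e) ^ n)\<close>, so Stirling's formula becomes convergence to
  \<open>ln (2 * pi) / 2\<close>.\<close>

definition stirling_err :: "nat \<Rightarrow> real" where
  "stirling_err n = ln (fact n) - (real n + 1/2) * ln (real n) + real n"

text \<open>The summand \<open>1/2\<close> beside \<open>n\<close> cancels the \<open>1 / n\<close>
  term of the increments, which are therefore \<open>O(1 / n^2)\<close>; summability and telescoping
  give a limit.\<close>

lemma convergent_stirling_err: "convergent stirling_err"
proof -
  have eq: "stirling_err (Suc n) - stirling_err n = 1 - (real n + 1/2) * ln (1 + 1 / real n)" if "n > 0" for n
  proof -
    have "ln (1 + 1 / real n) = ln (real (Suc n)) - ln (real n)"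
      using that by (subst ln_divide_pos [symmetric]) (auto simp: add_divide_distrib add.commute)
    moreover have "ln (fact (Suc n) :: real) = ln (real (Suc n)) + ln (fact n)"
      by (simp add: ln_mult)
    ultimately show ?thesis
      unfolding stirling_err_def by (simp only: of_nat_Suc) (simp add: field_simps)
  qed
  have "(\<lambda>n. 1 - (real n + 1/2) * ln (1 + 1 / real n)) \<in> O(\<lambda>n. 1 / real n ^ 2)"
    by real_asymp
  also have "?this \<longleftrightarrow> (\<lambda>n. stirling_err (Suc n) - stirling_err n) \<in> O(\<lambda>n. 1 / real n ^ 2)"
    by (intro landau_o.big.in_cong eventually_mono [OF eventually_gt_at_top[of 0]]) (use eq in auto)
  finally have "summable (\<lambda>n. stirling_err (Suc n) - stirling_err n)"
    by (rule summable_comparison_test_bigo [rotated])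
       (use inverse_power_summable[of 2, where ?'a = real] in \<open>simp add: field_simps\<close>)
  from summable_LIMSEQ[OF this]
  have "convergent (\<lambda>n. (stirling_err n - stirling_err 0) + stirling_err 0)"
    unfolding sum_lessThan_telescope by (intro convergent_add convergent_const) (auto simp: convergent_def)
  thus ?thesis by simp
qed

text \<open>Through factorials the logarithm of Wallis's product becomes a combination of
  \<open>stirling_err n\<close>, \<open>stirling_err (2 * n)\<close> and elementary
  logarithms.\<close>

lemma wallis_prod_eq:
  "(\<Prod>k=1..n. (4 * real k ^ 2) / (4 * real k ^ 2 - 1)) =
     (2 ^ n * fact n) ^ 4 / ((fact (2 * n))\<^sup>2 * (2 * real n + 1))"
proof (induction n)
  case (Suc n)
  have "4 * real (Suc n) ^ 2 - 1 = (2 * real n + 1) * (2 * real n + 3)"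
    by (simp add: power2_eq_square algebra_simps)
  moreover have "(fact (2 * Suc n) :: real) = (2 * real n + 2) * (2 * real n + 1) * fact (2 * n)"
    by (simp add: algebra_simps)
  moreover have "(2 ^ Suc n * fact (Suc n) :: real) = (2 * real n + 2) * (2 ^ n * fact n)"
    by (simp add: algebra_simps)
  ultimately have "(\<Prod>k=1..Suc n. (4 * real k ^ 2) / (4 * real k ^ 2 - 1)) =
     (2 ^ n * fact n) ^ 4 / ((fact (2 * n))\<^sup>2 * (2 * real n + 1)) * ((2 * real n + 2)^2 / ((2 * real n + 1) * (2 * real n + 3)))"
    using Suc.IH by (simp add: power2_eq_square algebra_simps)
  moreover have "A ^ 4 / (B\<^sup>2 * x) * (y ^ 2 / (x * z)) = (y * A) ^ 4 / ((y * x * B)^2 * z)"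
    if "x > 0" "z > 0" "B > 0" "y > 0" for A B x y z :: real
    using that by (simp add: divide_simps) (simp add: power_mult_distrib power2_eq_square power4_eq_xxxx)
  from this[of "2 * real n + 1" "2 * real n + 3" "fact (2 * n)" "2 * real n + 2" "2 ^ n * fact n"]
  have "(2 ^ n * fact n) ^ 4 / ((fact (2 * n))\<^sup>2 * (2 * real n + 1)) * ((2 * real n + 2)^2 / ((2 * real n + 1) * (2 * real n + 3)))
    = ((2 * real n + 2) * (2 ^ n * fact n)) ^ 4 / (((2 * real n + 2) * (2 * real n + 1) * fact (2 * n))\<^sup>2 * (2 * real n + 3))"
    by auto
  ultimately show ?case
    using \<open>fact (2 * Suc n) = _\<close> \<open>2 ^ Suc n * fact (Suc n) = (_::real)\<close> by (simp add: algebra_simps)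
qed simp

text \<open>The values at \<open>n\<close> and at \<open>2 * n\<close> share the limit
  \<open>c\<close>, so Wallis's product yields an equation for \<open>4 * c - 2 * c\<close>, which
  determines \<open>c\<close>.\<close>

theorem stirling_err_tendsto: "stirling_err \<longlonglongrightarrow> ln (2 * pi) / 2"
proof -
  obtain c where c: "stirling_err \<longlonglongrightarrow> c"
    using convergent_stirling_err by (auto simp: convergent_def)
  have c2: "(\<lambda>n. stirling_err (2 * n)) \<longlonglongrightarrow> c"
    by (rule LIMSEQ_subseq_LIMSEQ[OF c, unfolded o_def]) (auto simp: strict_mono_def)
  have "(\<lambda>n. ln (\<Prod>k=1..n. (4 * real k ^ 2) / (4 * real k ^ 2 - 1))) \<longlonglongrightarrow> ln (pi / 2)"
    by (intro tendsto_ln wallis) auto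
  also have "?this \<longleftrightarrow> (\<lambda>n. 4 * stirling_err n - 2 * stirling_err (2 * n) + 2 * ln (real n) -
                ln (2 * real n) - ln (2 * real n + 1)) \<longlonglongrightarrow> ln (pi / 2)"
  proof (intro filterlim_cong eventually_mono [OF eventually_gt_at_top[of 0]] refl)
    fix n :: nat assume n: "n > 0"
    have "ln (\<Prod>k=1..n. (4 * real k ^ 2) / (4 * real k ^ 2 - 1)) =
        4 * (n * ln 2 + ln (fact n)) - (2 * ln (fact (2 * n)) + ln (2 * real n + 1))"
      unfolding wallis_prod_eq using n
      by (simp add: ln_div ln_mult ln_realpow)
    thus "ln (\<Prod>k=1..n. (4 * real k ^ 2) / (4 * real k ^ 2 - 1)) =
       4 * stirling_err n - 2 * stirling_err (2 * n) + 2 * ln (real n) - ln (2 * real n) - ln (2 * real n + 1)"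
      using n by (simp add: stirling_err_def ln_mult algebra_simps)
  qed
  finally have lim1: "(\<lambda>n. 4 * stirling_err n - 2 * stirling_err (2 * n) + 2 * ln (real n) -
                ln (2 * real n) - ln (2 * real n + 1)) \<longlonglongrightarrow> ln (pi / 2)" .
  have "(\<lambda>n. 2 * ln (real n) - ln (2 * real n) - ln (2 * real n + 1)) \<longlonglongrightarrow> - 2 * ln 2"
    by real_asymp
  from tendsto_diff[OF lim1 this]
  have "(\<lambda>n. 4 * stirling_err n - 2 * stirling_err (2 * n)) \<longlonglongrightarrow> ln (pi / 2) + 2 * ln 2"
    by (simp add: algebra_simps)
  moreover have "(\<lambda>n. 4 * stirling_err n - 2 * stirling_err (2 * n)) \<longlonglongrightarrow> 4 * c - 2 * c"
    by (intro tendsto_intros c c2)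
  ultimately have "4 * c - 2 * c = ln (pi / 2) + 2 * ln 2"
    using LIMSEQ_unique by blast
  hence "c = ln (2 * pi) / 2"
    by (simp add: ln_div ln_mult field_simps)
  with c show ?thesis by (simp only:)
qed

text \<open>The Taylor series is \<open>u^2 + u^4 / 6 + ...\<close> with even powers only, so there
  is no cubic error. This is the source of the fourth powers in the later hypotheses.\<close>

lemma entropy_quartic_bound:
  "\<exists>C>0. \<exists>\<delta>>0. \<forall>u::real. \<bar>u\<bar> < \<delta> \<longrightarrow>
     \<bar>(1 + u) * ln (1 + u) + (1 - u) * ln (1 - u) - u ^ 2\<bar> \<le> C * u ^ 4"
proof -
  have "(\<lambda>u::real. (1 + u) * ln (1 + u) + (1 - u) * ln (1 - u) - u ^ 2) \<in> O[at_right 0](\<lambda>u. u ^ 4)"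
    by real_asymp
  then obtain C where C: "C > 0" and
    "\<forall>\<^sub>F u::real in at_right 0. norm ((1 + u) * ln (1 + u) + (1 - u) * ln (1 - u) - u ^ 2) \<le> C * norm (u ^ 4)"
    by (rule landau_o.bigE)
  hence ev: "\<forall>\<^sub>F u::real in at_right 0. \<bar>(1 + u) * ln (1 + u) + (1 - u) * ln (1 - u) - u ^ 2\<bar> \<le> C * u ^ 4"
    by simp
  then obtain \<delta> where \<delta>: "\<delta> > 0" and
    bd: "\<And>u. 0 < u \<Longrightarrow> u < \<delta> \<Longrightarrow> \<bar>(1 + u) * ln (1 + u) + (1 - u) * ln (1 - u) - u ^ 2\<bar> \<le> C * u ^ 4"
    by (auto simp: eventually_at_right_field)
  \<comment> \<open>Evenness in \<open>u\<close> transfers the one-sided estimate to negative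
    arguments.\<close>
  have "\<bar>(1 + u) * ln (1 + u) + (1 - u) * ln (1 - u) - u ^ 2\<bar> \<le> C * u ^ 4" if "\<bar>u\<bar> < \<delta>" for u
    using bd[of "\<bar>u\<bar>"] that by (cases "u = 0"; cases "u > 0") (auto simp: algebra_simps)
  thus ?thesis using C \<delta> by blast
qed

section \<open>Tails of the symmetric binomial distribution\<close>

definition sym_binom :: "nat \<Rightarrow> nat \<Rightarrow> real" where
  "sym_binom M k = real (M choose k) / 2 ^ M"

text \<open>With \<open>k = M (1 + u) / 2\<close>, Stirling's formula leaves the entropy
  \<open>(1 + u) ln (1 + u) + (1 - u) ln (1 - u)\<close> in the exponent.\<close>
lemma ln_sym_binom:
  assumes "0 < k" "k < M" and u: "u = (2 * real k - real M) / real M"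
  shows "ln (sym_binom M k * sqrt (real M) * sqrt (pi / 2) * exp (real M * u\<^sup>2 / 2)) =
     stirling_err M - stirling_err k - stirling_err (M - k) + ln (2 * pi) / 2
     - real M / 2 * ((1 + u) * ln (1 + u) + (1 - u) * ln (1 - u) - u\<^sup>2) - (ln (1 + u) + ln (1 - u)) / 2"
proof -
  have k: "real k = real M * (1 + u) / 2" and Mk: "real (M - k) = real M * (1 - u) / 2"
    using assms by (auto simp: field_simps of_nat_diff)
  have pos: "1 + u > 0" "1 - u > 0" "real M > 0"
    using assms(1,2) unfolding u by (auto simp: field_simps)
  have lnk: "ln (real k) = ln (real M) + ln (1 + u) - ln 2"
            "ln (real (M - k)) = ln (real M) + ln (1 - u) - ln 2"
    unfolding k Mk using pos by (simp_all add: ln_div ln_mult)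
  have "real (M choose k) = fact M / (fact k * fact (M - k))"
    using assms by (simp add: binomial_fact)
  hence "ln (sym_binom M k * sqrt (real M) * sqrt (pi / 2) * exp (real M * u\<^sup>2 / 2)) =
      ln (fact M) - (ln (fact k) + ln (fact (M - k))) - real M * ln 2 + ln (real M) / 2 + (ln pi - ln 2) / 2
      + real M * u\<^sup>2 / 2"
    using pos by (simp add: sym_binom_def ln_mult ln_div ln_realpow ln_sqrt)
  also have "\<dots> = stirling_err M - stirling_err k - stirling_err (M - k)
      + (real M + 1/2) * ln (real M) - (real k + 1/2) * ln (real k) - (real (M - k) + 1/2) * ln (real (M - k))
      - real M * ln 2 + ln (real M) / 2 + (ln pi - ln 2) / 2 + real M * u\<^sup>2 / 2"
    using assms by (simp add: stirling_err_def of_nat_diff)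
  also have "\<dots> = stirling_err M - stirling_err k - stirling_err (M - k) + ln (2 * pi) / 2
     - real M / 2 * ((1 + u) * ln (1 + u) + (1 - u) * ln (1 - u) - u\<^sup>2) - (ln (1 + u) + ln (1 - u)) / 2"
    unfolding lnk unfolding k Mk using pos by (simp add: ln_mult algebra_simps add_divide_distrib diff_divide_distrib)
  finally show ?thesis .
qed

text \<open>A local limit theorem for moderate deviations: the entropy differs from
  \<open>u^2\<close> by \<open>O(u^4)\<close>, so the Gaussian exponent is off by an amount of order
  \<open>M * u^4\<close>, while Stirling's formula supplies the prefactor.\<close>

lemma sym_binom_local_limit:
  fixes M k :: "nat \<Rightarrow> nat"
  defines "u \<equiv> (\<lambda>n. (2 * real (k n) - real (M n)) / real (M n))"
  assumes M: "filterlim M at_top sequentially"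
    and u4: "(\<lambda>n. real (M n) * u n ^ 4) \<longlonglongrightarrow> 0"
  shows "(\<lambda>n. sym_binom (M n) (k n) * sqrt (real (M n)) * sqrt (pi / 2) * exp (real (M n) * u n ^ 2 / 2)) \<longlonglongrightarrow> 1"
proof -
  have rM: "filterlim (\<lambda>n. real (M n)) at_top sequentially"
    by (rule filterlim_compose[OF filterlim_real_sequentially M])
  have Mpos: "\<forall>\<^sub>F n in sequentially. M n > 0"
    using M unfolding filterlim_at_top by (auto simp: Suc_le_eq dest: spec[of _ 1])
  have "(\<lambda>n. u n ^ 4) \<longlonglongrightarrow> 0"
  proof (rule Lim_null_comparison [OF _ u4])
    show "\<forall>\<^sub>F n in sequentially. norm (u n ^ 4) \<le> real (M n) * u n ^ 4"
      using Mpos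
    proof eventually_elim
      case (elim n)
      hence "1 * u n ^ 4 \<le> real (M n) * u n ^ 4" by (intro mult_right_mono) auto
      thus ?case by simp
    qed
  qed
  hence "(\<lambda>n. sqrt (sqrt ((u n ^ 2) ^ 2))) \<longlonglongrightarrow> sqrt (sqrt 0)"
    by (intro tendsto_real_sqrt) (simp flip: power_mult)
  hence u0: "u \<longlonglongrightarrow> 0"
    by (simp only: real_sqrt_abs abs_power2 real_sqrt_zero tendsto_rabs_zero_iff)
  have "\<forall>\<^sub>F n in sequentially. \<bar>u n\<bar> < 1"
    by (rule order_tendstoD(2)[OF tendsto_rabs_zero[OF u0]]) simp
  \<comment> \<open>Since \<open>k = M * (1 + u) / 2\<close>, smallness of \<open>u\<close> keeps
    \<open>k\<close> strictly between 0 and \<open>M\<close>; the same formula then sends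
    \<open>k\<close> and \<open>M - k\<close> to infinity, so that Stirling's formula applies to all
    three factorials.\<close>
  hence ev: "\<forall>\<^sub>F n in sequentially. 0 < k n \<and> k n < M n"
    using Mpos by eventually_elim (auto simp: u_def abs_if field_simps split: if_splits)
  have "filterlim (\<lambda>n. (1 + u n) / 2 * real (M n)) at_top sequentially"
    by (rule filterlim_tendsto_pos_mult_at_top[OF _ _ rM, of _ "1/2"])
       (auto intro!: tendsto_eq_intros u0)
  hence k: "filterlim k at_top sequentially"
    unfolding filterlim_sequentially_iff_filterlim_real
    by (rule filterlim_mono_eventually) (use Mpos in \<open>auto elim!: eventually_mono simp: u_def field_simps\<close>)
  have "filterlim (\<lambda>n. (1 - u n) / 2 * real (M n)) at_top sequentially"
    by (rule filterlim_tendsto_pos_mult_at_top[OF _ _ rM, of _ "1/2"])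
       (auto intro!: tendsto_eq_intros u0)
  hence Mk: "filterlim (\<lambda>n. M n - k n) at_top sequentially"
    unfolding filterlim_sequentially_iff_filterlim_real
    by (rule filterlim_mono_eventually)
       (use ev in \<open>auto elim!: eventually_mono simp: u_def field_simps of_nat_diff\<close>)
  obtain C \<delta> :: real where C: "C > 0" "\<delta> > 0" and
    bd: "\<And>u. \<bar>u\<bar> < \<delta> \<Longrightarrow> \<bar>(1 + u) * ln (1 + u) + (1 - u) * ln (1 - u) - u ^ 2\<bar> \<le> C * u ^ 4"
    using entropy_quartic_bound by blast
  have ent: "(\<lambda>n. real (M n) / 2 * ((1 + u n) * ln (1 + u n) + (1 - u n) * ln (1 - u n) - u n ^ 2)) \<longlonglongrightarrow> 0"
  proof (rule Lim_null_comparison)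
    have "\<forall>\<^sub>F n in sequentially. \<bar>u n\<bar> < \<delta>"
      by (rule order_tendstoD(2)[OF tendsto_rabs_zero[OF u0]]) (fact C(2))
    thus "\<forall>\<^sub>F n in sequentially. norm (real (M n) / 2 * ((1 + u n) * ln (1 + u n) + (1 - u n) * ln (1 - u n) - u n ^ 2))
            \<le> C / 2 * (real (M n) * u n ^ 4)"
    proof eventually_elim
      case (elim n)
      from mult_left_mono[OF bd[OF elim], of "real (M n) / 2"] show ?case
        by (simp add: abs_mult mult_ac)
    qed
    show "(\<lambda>n. C / 2 * (real (M n) * u n ^ 4)) \<longlonglongrightarrow> 0"
      using tendsto_mult_right_zero[OF u4] by simp
  qed
  \<comment> \<open>The constants \<open>ln (2 * pi) / 2\<close> enter as one minus two plus one and
    cancel.\<close>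
  have "(\<lambda>n. stirling_err (M n) - stirling_err (k n) - stirling_err (M n - k n) + ln (2 * pi) / 2
     - real (M n) / 2 * ((1 + u n) * ln (1 + u n) + (1 - u n) * ln (1 - u n) - u n ^ 2) - (ln (1 + u n) + ln (1 - u n)) / 2)
     \<longlonglongrightarrow> ln (2 * pi) / 2 - ln (2 * pi) / 2 - ln (2 * pi) / 2 + ln (2 * pi) / 2 - 0 - (ln (1 + 0) + ln (1 - 0)) / 2"
    by (intro tendsto_intros ent u0 filterlim_compose[OF stirling_err_tendsto] M k Mk) auto
  hence "(\<lambda>n. exp (stirling_err (M n) - stirling_err (k n) - stirling_err (M n - k n) + ln (2 * pi) / 2
     - real (M n) / 2 * ((1 + u n) * ln (1 + u n) + (1 - u n) * ln (1 - u n) - u n ^ 2) - (ln (1 + u n) + ln (1 - u n)) / 2))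
     \<longlonglongrightarrow> exp 0"
    by (intro tendsto_exp) simp
  also have "?this \<longleftrightarrow> ?thesis"
    unfolding exp_zero
  proof (intro filterlim_cong refl eventually_mono[OF ev], goal_cases)
    case (1 n)
    have "sym_binom (M n) (k n) > 0" using 1 by (simp add: sym_binom_def)
    hence "sym_binom (M n) (k n) * sqrt (real (M n)) * sqrt (pi / 2) * exp (real (M n) * u n ^ 2 / 2) > 0"
      using 1 by simp
    thus ?case
      using 1 by (subst ln_sym_binom[symmetric]) (auto simp: u_def)
  qed
  finally show ?thesis .
qed

section \<open>Geometric bounds for binomial tails\<close>

lemma sym_binom_Suc: "j < M \<Longrightarrow> sym_binom M (Suc j) = sym_binom M j * ((real M - real j) / (real j + 1))"
proof -
  assume "j < M"
  have "Suc j * (M choose Suc j) = (M - j) * (M choose j)"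
    by (metis binomial_absorb_comp binomial_absorption)
  hence "real (Suc j) * real (M choose Suc j) = (real M - real j) * real (M choose j)"
    using \<open>j < M\<close> by (metis less_imp_le of_nat_diff of_nat_mult)
  hence "real (M choose Suc j) = real (M choose j) * ((real M - real j) / (real j + 1))"
    by (simp add: field_simps)
  thus ?thesis by (simp add: sym_binom_def)
qed

lemma sym_binom_nonneg [simp]: "sym_binom M j \<ge> 0"
  by (simp add: sym_binom_def)

lemma sym_binom_eq_0: "j > M \<Longrightarrow> sym_binom M j = 0"
  by (simp add: sym_binom_def)

text \<open>Ratios of consecutive terms decrease, so the ratio at \<open>k\<close> dominates all
  later ones; beyond \<open>M\<close> the terms vanish.\<close>

lemma sym_binom_le_geometric:
  assumes "k \<le> M"
  shows "sym_binom M (k + i) \<le> sym_binom M k * ((real M - real k) / (real k + 1)) ^ i"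
proof (induction i)
  case (Suc i)
  define r where "r = (real M - real k) / (real k + 1)"
  have r: "r \<ge> 0" using assms by (simp add: r_def)
  show ?case
  proof (cases "k + i < M")
    case True
    have "sym_binom M (k + Suc i) = sym_binom M (k + i) * ((real M - real (k + i)) / (real (k + i) + 1))"
      using sym_binom_Suc[OF True] by simp
    also have "\<dots> \<le> sym_binom M (k + i) * r"
      unfolding r_def using True by (intro mult_left_mono frac_le) auto
    also have "\<dots> \<le> (sym_binom M k * r ^ i) * r"
      using Suc r by (intro mult_right_mono) (auto simp: r_def)
    finally show ?thesis by (simp add: r_def mult_ac)
  next
    case False
    thus ?thesis using r by (simp add: sym_binom_eq_0 r_def[symmetric])
  qed
qed simp

text \<open>The ratios decrease, so the one at \<open>k + L\<close> bounds all those used before it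
  from below.\<close>

lemma sym_binom_ge_geometric:
  assumes "k + L \<le> M" "i \<le> L"
  shows "sym_binom M (k + i) \<ge> sym_binom M k * ((real M - real (k + L)) / (real (k + L) + 1)) ^ i"
  using assms(2)
proof (induction i)
  case (Suc i)
  define r where "r = (real M - real (k + L)) / (real (k + L) + 1)"
  have r: "r \<ge> 0" using assms by (simp add: r_def)
  have less: "k + i < M" using assms Suc.prems by simp
  have "(sym_binom M k * r ^ i) * r \<le> sym_binom M (k + i) * r"
    using Suc r by (intro mult_right_mono) (auto simp: r_def)
  also have "\<dots> \<le> sym_binom M (k + i) * ((real M - real (k + i)) / (real (k + i) + 1))"
    unfolding r_def using assms Suc.prems less by (intro mult_left_mono frac_le) auto
  also have "\<dots> = sym_binom M (k + Suc i)"
    using sym_binom_Suc[OF less] by simp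
  finally show ?case by (simp add: r_def mult_ac)
qed simp

definition sym_binom_tail :: "nat \<Rightarrow> nat \<Rightarrow> real" where
  "sym_binom_tail M k = (\<Sum>j\<in>{k..M}. sym_binom M j)"

text \<open>The condition \<open>M < 2 * k + 1\<close> says exactly that the geometric majorant has
  ratio below 1; its full sum is \<open>1 / (1 - r)\<close>.\<close>

lemma sym_binom_tail_le:
  assumes "k \<le> M" "M < 2 * k + 1"
  shows "sym_binom_tail M k \<le> sym_binom M k * (real k + 1) / (2 * real k + 1 - real M)"
proof -
  define r where "r = (real M - real k) / (real k + 1)"
  have r: "0 \<le> r" "r < 1" using assms by (auto simp: r_def field_simps)
  have "sym_binom_tail M k = (\<Sum>i\<le>M - k. sym_binom M (k + i))"
    unfolding sym_binom_tail_def
    by (rule sum.reindex_bij_witness[of _ "\<lambda>i. k + i" "\<lambda>j. j - k"]) (use assms in auto)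
  also have "\<dots> \<le> (\<Sum>i\<le>M - k. sym_binom M k * r ^ i)"
    unfolding r_def by (intro sum_mono sym_binom_le_geometric assms)
  also have "\<dots> = sym_binom M k * ((1 - r ^ Suc (M - k)) / (1 - r))"
    using r sum_gp0[of r "M - k"] by (simp add: sum_distrib_left [symmetric])
  also have "\<dots> \<le> sym_binom M k * (1 / (1 - r))"
    using r by (intro mult_left_mono divide_right_mono) auto
  also have "1 / (1 - r) = (real k + 1) / (2 * real k + 1 - real M)"
    by (simp add: r_def field_simps)
  finally show ?thesis by simp
qed

text \<open>Only the first \<open>L\<close> terms are kept. Their geometric minorant has ratio
  \<open>1 - w\<close>, and the relative loss \<open>(1 - w) ^ L\<close> is at most
  \<open>exp (- L * w)\<close>, negligible once \<open>L * w\<close> is large.\<close>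

lemma sym_binom_tail_ge:
  assumes "k + L \<le> M" "M < 2 * k + 1"
  defines "w \<equiv> (2 * real (k + L) + 1 - real M) / (real (k + L) + 1)"
  shows "sym_binom_tail M k \<ge> sym_binom M k * (1 - exp (- (real L * w))) / w"
proof -
  define r where "r = (real M - real (k + L)) / (real (k + L) + 1)"
  have rw: "r = 1 - w" by (simp add: r_def w_def field_simps)
  have r: "0 \<le> r" "r < 1" using assms(1,2) by (auto simp: r_def field_simps)
  have "exp (- (real L * w)) = exp (-w) ^ L"
    by (simp add: exp_of_nat_mult [symmetric])
  moreover have "r ^ L \<le> exp (-w) ^ L"
    using exp_ge_add_one_self[of "-w"] r by (intro power_mono) (auto simp: rw)
  ultimately have "sym_binom M k * (1 - exp (- (real L * w))) / w \<le> sym_binom M k * ((1 - r ^ L) / (1 - r))"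
    using r rw by (auto intro!: divide_right_mono mult_left_mono)
  also have "(1 - r ^ L) / (1 - r) = (\<Sum>i<L. r ^ i)"
    using r by (simp add: sum_gp_strict)
  also have "sym_binom M k * (\<Sum>i<L. r ^ i) = (\<Sum>i<L. sym_binom M k * r ^ i)"
    by (simp add: sum_distrib_left)
  also have "\<dots> \<le> (\<Sum>i<L. sym_binom M (k + i))"
    unfolding r_def by (intro sum_mono sym_binom_ge_geometric assms) auto
  also have "\<dots> = (\<Sum>j\<in>{k..<k+L}. sym_binom M j)"
    by (rule sum.reindex_bij_witness[of _ "\<lambda>j. j - k" "\<lambda>i. k + i"]) auto
  also have "\<dots> \<le> sym_binom_tail M k"
    unfolding sym_binom_tail_def using assms by (intro sum_mono2) auto
  finally show ?thesis .
qed

text \<open>Summing \<open>L = \<lfloor>sqrt M\<rfloor>\<close> terms suffices: over that range the ratio of consecutive terms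
  stays \<open>1 - (2 + o(1)) v / sqrt M\<close>, while \<open>L v / sqrt M \<rightarrow> \<infinity>\<close> exhausts the geometric series.\<close>
lemma sym_binom_tail_asymp:
  fixes M k :: "nat \<Rightarrow> nat"
  defines "v \<equiv> (\<lambda>n. (2 * real (k n) - real (M n)) / sqrt (real (M n)))"
  assumes M: "filterlim M at_top sequentially"
    and v: "filterlim v at_top sequentially"
    and v4: "(\<lambda>n. v n ^ 4 / real (M n)) \<longlonglongrightarrow> 0"
  shows "(\<lambda>n. sym_binom_tail (M n) (k n) * v n * sqrt (2 * pi) * exp (v n ^ 2 / 2)) \<longlonglongrightarrow> 1"
proof -
  define s where "s = (\<lambda>n. sqrt (real (M n)))"
  have rM: "filterlim (\<lambda>n. real (M n)) at_top sequentially"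
    by (rule filterlim_compose[OF filterlim_real_sequentially M])
  have s: "filterlim s at_top sequentially"
    unfolding s_def by (rule filterlim_compose[OF sqrt_at_top rM])
  have s_inv: "(\<lambda>n. 1 / s n) \<longlonglongrightarrow> 0"
    by (rule real_tendsto_divide_at_top[OF tendsto_const s])
  have v_inv: "(\<lambda>n. 1 / v n) \<longlonglongrightarrow> 0"
    by (rule real_tendsto_divide_at_top[OF tendsto_const v])
  have ev0: "\<forall>\<^sub>F n in sequentially. s n > 1 \<and> v n > 1"
    using s v unfolding filterlim_at_top_dense by (auto intro: eventually_conj)
  have Ms: "real (M n) = s n * s n" for n by (simp add: s_def)
  have k_eq: "real (k n) = (s n * s n + v n * s n) / 2" if "s n > 1" for n
    using that by (simp add: v_def s_def[symmetric] Ms)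
  \<comment> \<open>Because \<open>v > 1\<close> eventually, \<open>v / s\<close> is at most
    \<open>v^2 / s = sqrt (v^4 / M)\<close>, which \<open>v4\<close> controls.\<close>
  have vs: "(\<lambda>n. v n / s n) \<longlonglongrightarrow> 0"
  proof (rule Lim_null_comparison)
    show "\<forall>\<^sub>F n in sequentially. norm (v n / s n) \<le> sqrt (v n ^ 4 / real (M n))"
      using ev0
    proof eventually_elim
      case (elim n)
      have "v n / s n \<le> v n ^ 2 / s n"
        using elim by (intro divide_right_mono) (auto simp: power2_eq_square)
      also have "\<dots> = sqrt (v n ^ 4 / real (M n))"
        by (simp add: real_sqrt_divide s_def) (metis power2_abs power_mult_numeral real_sqrt_abs abs_power2 num_double)
      finally show ?case using elim by simp
    qed
    show "(\<lambda>n. sqrt (v n ^ 4 / real (M n))) \<longlonglongrightarrow> 0"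
      using tendsto_real_sqrt[OF v4] by simp
  qed
  define u where "u = (\<lambda>n. (2 * real (k n) - real (M n)) / real (M n))"
  have u: "u n = v n / s n" for n
    by (simp add: u_def v_def s_def)
  have loc: "(\<lambda>n. sym_binom (M n) (k n) * s n * sqrt (pi / 2) * exp (v n ^ 2 / 2)) \<longlonglongrightarrow> 1"
  proof -
    have "(\<lambda>n. real (M n) * u n ^ 4) \<longlonglongrightarrow> 0"
    proof (rule Lim_transform_eventually[OF v4])
      show "\<forall>\<^sub>F n in sequentially. v n ^ 4 / real (M n) = real (M n) * u n ^ 4"
        using ev0 by eventually_elim (simp add: u Ms field_simps power4_eq_xxxx)
    qed
    hence "(\<lambda>n. sym_binom (M n) (k n) * s n * sqrt (pi / 2) * exp (real (M n) * (u n)\<^sup>2 / 2)) \<longlonglongrightarrow> 1"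
      using sym_binom_local_limit[OF M, of k] unfolding u_def s_def by blast
    thus ?thesis
    proof (rule Lim_transform_eventually)
      show "\<forall>\<^sub>F n in sequentially. sym_binom (M n) (k n) * s n * sqrt (pi / 2) * exp (real (M n) * (u n)\<^sup>2 / 2) =
              sym_binom (M n) (k n) * s n * sqrt (pi / 2) * exp (v n ^ 2 / 2)"
        using ev0 by eventually_elim (simp add: u Ms power2_eq_square)
    qed
  qed
  define L where "L = (\<lambda>n. nat \<lfloor>s n\<rfloor>)"
  have L: "real (L n) \<le> s n" "real (L n) \<ge> s n - 1" if "s n > 1" for n
    using that unfolding L_def by linarith+
  define w where "w = (\<lambda>n. (2 * real (k n + L n) + 1 - real (M n)) / (real (k n + L n) + 1))"
  have L_s: "(\<lambda>n. real (L n) / s n) \<longlonglongrightarrow> 1"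
  proof (rule tendsto_sandwich)
    show "\<forall>\<^sub>F n in sequentially. 1 - 1 / s n \<le> real (L n) / s n"
      using ev0
    proof eventually_elim
      case (elim n)
      hence "(s n - 1) / s n \<le> real (L n) / s n"
        using L(2)[of n] by (intro divide_right_mono) auto
      thus ?case using elim by (simp add: diff_divide_distrib)
    qed
    show "\<forall>\<^sub>F n in sequentially. real (L n) / s n \<le> 1"
      using ev0 by eventually_elim (use L in \<open>simp add: field_simps\<close>)
    show "(\<lambda>n. 1 - 1 / s n) \<longlonglongrightarrow> 1"
      using tendsto_diff[OF tendsto_const[of 1] s_inv] by simp
  qed auto
  \<comment> \<open>The numerator of \<open>w\<close> divided by \<open>v * s\<close> and its
    denominator divided by \<open>s^2 / 2\<close> both tend to 1, as \<open>L\<close> is of order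
    \<open>s\<close> and \<open>v / s\<close> vanishes; so \<open>w\<close> behaves like
    \<open>2 * v / s\<close>.\<close>
  have sw: "(\<lambda>n. s n * w n / (2 * v n)) \<longlonglongrightarrow> 1"
  proof -
    have "(\<lambda>n. (1 + 2 * (real (L n) / s n) * (1 / v n) + (1 / v n) * (1 / s n)) /
              (1 + v n / s n + 2 * (real (L n) / s n) * (1 / s n) + 2 * (1 / s n) * (1 / s n))) \<longlonglongrightarrow>
            (1 + 2 * 1 * 0 + 0 * 0) / (1 + 0 + 2 * 1 * 0 + 2 * 0 * 0)"
      by (intro tendsto_intros L_s v_inv s_inv vs) auto
    hence "(\<lambda>n. (1 + 2 * (real (L n) / s n) * (1 / v n) + (1 / v n) * (1 / s n)) /
              (1 + v n / s n + 2 * (real (L n) / s n) * (1 / s n) + 2 * (1 / s n) * (1 / s n))) \<longlonglongrightarrow> 1"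
      by simp
    thus ?thesis
    proof (rule Lim_transform_eventually)
      show "\<forall>\<^sub>F n in sequentially. (1 + 2 * (real (L n) / s n) * (1 / v n) + (1 / v n) * (1 / s n)) /
              (1 + v n / s n + 2 * (real (L n) / s n) * (1 / s n) + 2 * (1 / s n) * (1 / s n)) = s n * w n / (2 * v n)"
        using ev0
      proof eventually_elim
        case (elim n)
        define l where "l = real (L n)"
        have eq: "w n = (v n * s n + 2 * l + 1) / ((s n * s n + v n * s n) / 2 + l + 1)"
          using elim by (simp add: w_def Ms k_eq l_def algebra_simps)
        have pos: "s n > 0" "v n > 0" "l \<ge> 0" using elim by (auto simp: l_def)
        have quot: "(y / (v n * s n)) / (2 * z / (s n * s n)) = s n * (y / z) / (2 * v n)" for y z
          using pos by (simp add: mult_ac)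
        have "1 + 2 * (l / s n) * (1 / v n) + (1 / v n) * (1 / s n) = (v n * s n + 2 * l + 1) / (v n * s n)"
          using pos by (simp add: field_simps)
        moreover have "1 + v n / s n + 2 * (l / s n) * (1 / s n) + 2 * (1 / s n) * (1 / s n) =
            2 * ((s n * s n + v n * s n) / 2 + l + 1) / (s n * s n)"
          using pos by (simp add: field_simps)
        ultimately show ?case
          unfolding eq l_def[symmetric] by (simp only: quot)
      qed
    qed
  qed
  have Lw: "filterlim (\<lambda>n. real (L n) * w n) at_top sequentially"
  proof -
    have "filterlim (\<lambda>n. (real (L n) / s n) * (s n * w n / (2 * v n)) * (2 * v n)) at_top sequentially"
      by (rule filterlim_tendsto_pos_mult_at_top[OF tendsto_mult[OF L_s sw]])
         (auto intro!: filterlim_tendsto_pos_mult_at_top[OF tendsto_const _ v])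
    thus ?thesis
      by (rule filterlim_mono_eventually) (use ev0 in \<open>auto elim!: eventually_mono\<close>)
  qed
  have ev1: "\<forall>\<^sub>F n in sequentially. k n + L n \<le> M n"
  proof -
    have "\<forall>\<^sub>F n in sequentially. v n / s n < 1/2"
      using vs by (rule order_tendstoD) auto
    moreover have "\<forall>\<^sub>F n in sequentially. s n > 4"
      using s unfolding filterlim_at_top_dense by blast
    ultimately show ?thesis
    proof eventually_elim
      case (elim n)
      have s1: "s n > 1" using elim by simp
      have "v n * s n \<le> (s n * s n) / 2" using elim by (simp add: field_simps)
      moreover have "4 * s n \<le> s n * s n" using elim by (intro mult_right_mono) auto
      ultimately have "real (k n + L n) \<le> real (M n)"
        using L(1)[OF s1] unfolding Ms of_nat_add k_eq[OF s1] by (simp add: field_simps)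
      thus ?case by linarith
    qed
  qed
  have ev2: "\<forall>\<^sub>F n in sequentially. M n < 2 * k n + 1"
    using ev0
  proof eventually_elim
    case (elim n)
    have "s n * v n > 0" using elim by auto
    moreover have "2 * real (k n) = s n * s n + s n * v n"
      using k_eq[of n] elim by (simp add: mult.commute)
    ultimately have "real (M n) < 2 * real (k n) + 1"
      using Ms[of n] by linarith
    thus ?case by linarith
  qed
  \<comment> \<open>\<open>W\<close> is \<open>w\<close> with \<open>L = 0\<close>: one minus the
    ratio at the start of the tail, as needed for the upper bound.\<close>
  define W where "W = (\<lambda>n. (2 * real (k n) + 1 - real (M n)) / (real (k n) + 1))"
  have sW: "(\<lambda>n. s n * W n / (2 * v n)) \<longlonglongrightarrow> 1"
  proof -
    have "(\<lambda>n. (1 + (1 / v n) * (1 / s n)) / (1 + v n / s n + 2 * (1 / s n) * (1 / s n))) \<longlonglongrightarrow>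
            (1 + 0 * 0) / (1 + 0 + 2 * 0 * 0)"
      by (intro tendsto_intros v_inv s_inv vs) auto
    hence "(\<lambda>n. (1 + (1 / v n) * (1 / s n)) / (1 + v n / s n + 2 * (1 / s n) * (1 / s n))) \<longlonglongrightarrow> 1"
      by simp
    thus ?thesis
    proof (rule Lim_transform_eventually)
      show "\<forall>\<^sub>F n in sequentially. (1 + (1 / v n) * (1 / s n)) / (1 + v n / s n + 2 * (1 / s n) * (1 / s n)) = s n * W n / (2 * v n)"
        using ev0
      proof eventually_elim
        case (elim n)
        have eq: "W n = (v n * s n + 1) / ((s n * s n + v n * s n) / 2 + 1)"
          using elim by (simp add: W_def Ms k_eq algebra_simps)
        have pos: "s n > 0" "v n > 0" using elim by auto
        have quot: "(y / (v n * s n)) / (2 * z / (s n * s n)) = s n * (y / z) / (2 * v n)" for y z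
          using pos by (simp add: mult_ac)
        have "1 + (1 / v n) * (1 / s n) = (v n * s n + 1) / (v n * s n)"
          using pos by (simp add: field_simps)
        moreover have "1 + v n / s n + 2 * (1 / s n) * (1 / s n) =
            2 * ((s n * s n + v n * s n) / 2 + 1) / (s n * s n)"
          using pos by (simp add: field_simps)
        ultimately show ?case unfolding eq by (simp only: quot)
      qed
    qed
  qed
  define B where "B = (\<lambda>n. sym_binom (M n) (k n) * s n * sqrt (pi / 2) * exp (v n ^ 2 / 2))"
  \<comment> \<open>The factor 2 in this identity cancels the one in \<open>2 * v / s\<close>,
    leaving the constant \<open>sqrt (pi / 2)\<close> of the local limit.\<close>
  have sq: "sqrt (2 * pi) = 2 * sqrt (pi / 2)"
    using real_sqrt_mult[of 4 "pi / 2"] by simp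
  have sc: "sym_binom (M n) (k n) * c / z * v n * sqrt (2 * pi) * exp (v n ^ 2 / 2) = B n * c / (s n * z / (2 * v n))"
    if "s n > 1" "v n > 1" for n c z
    using that by (simp add: B_def sq)
  show ?thesis
  proof (rule tendsto_sandwich)
    show "\<forall>\<^sub>F n in sequentially. B n * (1 - exp (- (real (L n) * w n))) / (s n * w n / (2 * v n))
             \<le> sym_binom_tail (M n) (k n) * v n * sqrt (2 * pi) * exp (v n ^ 2 / 2)"
      using ev0 ev1 ev2
    proof eventually_elim
      case (elim n)
      have "sym_binom (M n) (k n) * (1 - exp (- (real (L n) * w n))) / w n \<le> sym_binom_tail (M n) (k n)"
        unfolding w_def by (rule sym_binom_tail_ge) (use elim in auto)
      hence "sym_binom (M n) (k n) * (1 - exp (- (real (L n) * w n))) / w n * v n * sqrt (2 * pi) * exp (v n ^ 2 / 2)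
         \<le> sym_binom_tail (M n) (k n) * v n * sqrt (2 * pi) * exp (v n ^ 2 / 2)"
        using elim by (intro mult_right_mono) auto
      thus ?case using elim by (subst (asm) sc) auto
    qed
    show "\<forall>\<^sub>F n in sequentially. sym_binom_tail (M n) (k n) * v n * sqrt (2 * pi) * exp (v n ^ 2 / 2)
            \<le> B n * 1 / (s n * W n / (2 * v n))"
      using ev0 ev1 ev2
    proof eventually_elim
      case (elim n)
      have "sym_binom_tail (M n) (k n) \<le> sym_binom (M n) (k n) * 1 / W n"
        using sym_binom_tail_le[of "k n" "M n"] elim by (simp add: W_def)
      hence "sym_binom_tail (M n) (k n) * v n * sqrt (2 * pi) * exp (v n ^ 2 / 2) \<le>
           sym_binom (M n) (k n) * 1 / W n * v n * sqrt (2 * pi) * exp (v n ^ 2 / 2)"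
        using elim by (intro mult_right_mono) auto
      thus ?case using elim by (subst (asm) sc) auto
    qed
    show "(\<lambda>n. B n * 1 / (s n * W n / (2 * v n))) \<longlonglongrightarrow> 1"
      using tendsto_divide[OF tendsto_mult[OF loc tendsto_const[of 1]] sW] by (simp add: B_def)
    have "(\<lambda>n. exp (- (real (L n) * w n))) \<longlonglongrightarrow> 0"
      by (rule filterlim_compose[OF exp_at_bot]) (use Lw in \<open>simp add: filterlim_uminus_at_top\<close>)
    hence "(\<lambda>n. B n * (1 - exp (- (real (L n) * w n))) / (s n * w n / (2 * v n))) \<longlonglongrightarrow> 1 * (1 - 0) / 1"
      by (intro tendsto_divide tendsto_mult tendsto_diff tendsto_const sw loc[folded B_def]) auto
    thus "(\<lambda>n. B n * (1 - exp (- (real (L n) * w n))) / (s n * w n / (2 * v n))) \<longlonglongrightarrow> 1"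
      by simp
  qed
qed

text \<open>A natural number exceeds \<open>c\<close> exactly when it is at least the floor of
  \<open>c\<close> plus one, also for integral \<open>c\<close>; \<open>c \<ge> 0\<close> keeps
  \<open>nat\<close> faithful.\<close>

lemma prob_binomial_half_greater:
  assumes "c \<ge> 0"
  shows "measure_pmf.prob (binomial_pmf M (1/2)) {b. real b > c} = sym_binom_tail M (nat \<lfloor>c\<rfloor> + 1)"
proof -
  let ?k = "nat \<lfloor>c\<rfloor> + 1"
  have "{b. real b > c} = {?k..}"
    using assms by (auto simp: Suc_le_eq nat_less_iff floor_less_iff)
  also have "measure_pmf.prob (binomial_pmf M (1/2)) {?k..} = measure_pmf.prob (binomial_pmf M (1/2)) {?k..M}"
    by (rule measure_prob_cong_0) (auto simp: power_divide)
  also have "\<dots> = (\<Sum>j\<in>{?k..M}. pmf (binomial_pmf M (1/2)) j)"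
    by (simp add: measure_measure_pmf_finite)
  also have "\<dots> = sym_binom_tail M ?k"
    unfolding sym_binom_tail_def
    by (intro sum.cong refl) (auto simp: sym_binom_def power_divide power_add[symmetric] field_simps)
  finally show ?thesis .
qed

text \<open>Rounding the threshold up to the next integer perturbs \<open>y\<close> only by \<open>O(1 / sqrt M)\<close>.\<close>
theorem binomial_half_tail_asymp:
  fixes M :: "nat \<Rightarrow> nat" and a :: "nat \<Rightarrow> real"
  defines "y \<equiv> (\<lambda>n. 2 * a n / sqrt (real (M n)))"
  assumes M: "filterlim M at_top sequentially"
    and y: "filterlim y at_top sequentially"
    and y4: "(\<lambda>n. y n ^ 4 / real (M n)) \<longlonglongrightarrow> 0"
  shows "(\<lambda>n. measure_pmf.prob (binomial_pmf (M n) (1/2)) {b. real b > real (M n) / 2 + a n} *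
             y n * sqrt (2 * pi) * exp (y n ^ 2 / 2)) \<longlonglongrightarrow> 1"
proof -
  define s where "s = (\<lambda>n. sqrt (real (M n)))"
  define k where "k = (\<lambda>n. nat \<lfloor>real (M n) / 2 + a n\<rfloor> + 1)"
  define v where "v = (\<lambda>n. (2 * real (k n) - real (M n)) / sqrt (real (M n)))"
  have rM: "filterlim (\<lambda>n. real (M n)) at_top sequentially"
    by (rule filterlim_compose[OF filterlim_real_sequentially M])
  have s: "filterlim s at_top sequentially"
    unfolding s_def by (rule filterlim_compose[OF sqrt_at_top rM])
  have s_inv: "(\<lambda>n. 1 / s n) \<longlonglongrightarrow> 0"
    by (rule real_tendsto_divide_at_top[OF tendsto_const s])
  have y_inv: "(\<lambda>n. 1 / y n) \<longlonglongrightarrow> 0"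
    by (rule real_tendsto_divide_at_top[OF tendsto_const y])
  have ev0: "\<forall>\<^sub>F n in sequentially. s n > 1 \<and> y n > 1"
    using s y unfolding filterlim_at_top_dense by (auto intro: eventually_conj)
  have Ms: "real (M n) = s n * s n" for n by (simp add: s_def)
  have s_alt: "sqrt (real (M n)) = s n" for n by (simp add: s_def)
  have ya: "a n = y n * s n / 2" if "s n > 1" for n
    using that by (simp add: y_def s_def)
  have vy: "y n < v n" "v n \<le> y n + 2 * (1 / s n)" if "s n > 1 \<and> y n > 1" for n
  proof -
    have pos: "a n > 0" using that by (simp add: ya)
    hence "real (k n) > real (M n) / 2 + a n" "real (k n) \<le> real (M n) / 2 + a n + 1"
      unfolding k_def by (auto simp: of_nat_nat) linarith+
    hence "2 * real (k n) - real (M n) > y n * s n" "2 * real (k n) - real (M n) \<le> (y n + 2 * (1 / s n)) * s n"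
      using that by (auto simp: ya distrib_right)
    thus "y n < v n" "v n \<le> y n + 2 * (1 / s n)"
      using that by (auto simp: v_def s_alt pos_less_divide_eq pos_divide_le_eq)
  qed
  have v: "filterlim v at_top sequentially"
    by (rule filterlim_at_top_mono[OF y]) (use ev0 vy in \<open>auto elim!: eventually_mono intro: less_imp_le\<close>)
  have ratio: "(\<lambda>n. v n / y n) \<longlonglongrightarrow> 1"
  proof (rule tendsto_sandwich)
    show "\<forall>\<^sub>F n in sequentially. 1 \<le> v n / y n"
      using ev0 by eventually_elim (use vy in \<open>auto simp: field_simps intro: less_imp_le\<close>)
    show "\<forall>\<^sub>F n in sequentially. v n / y n \<le> 1 + 2 * (1 / s n) * (1 / y n)"
      using ev0
    proof eventually_elim
      case (elim n)
      have "v n / y n \<le> (y n + 2 * (1 / s n)) / y n"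
        using elim vy(2)[OF elim] by (intro divide_right_mono) auto
      thus ?case using elim by (simp add: add_divide_distrib)
    qed
    have "(\<lambda>n. 1 + 2 * (1 / s n) * (1 / y n)) \<longlonglongrightarrow> 1 + 2 * 0 * 0"
      by (intro tendsto_intros s_inv y_inv)
    thus "(\<lambda>n. 1 + 2 * (1 / s n) * (1 / y n)) \<longlonglongrightarrow> 1" by simp
  qed auto
  have v4: "(\<lambda>n. v n ^ 4 / real (M n)) \<longlonglongrightarrow> 0"
  proof -
    have "(\<lambda>n. (v n / y n) ^ 4 * (y n ^ 4 / real (M n))) \<longlonglongrightarrow> 1 ^ 4 * 0"
      by (intro tendsto_intros ratio y4)
    hence "(\<lambda>n. (v n / y n) ^ 4 * (y n ^ 4 / real (M n))) \<longlonglongrightarrow> 0" by simp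
    thus ?thesis
      by (rule Lim_transform_eventually) (use ev0 in \<open>auto elim!: eventually_mono simp: power_divide\<close>)
  qed
  have ys: "(\<lambda>n. y n / s n) \<longlonglongrightarrow> 0"
  proof (rule Lim_null_comparison)
    show "\<forall>\<^sub>F n in sequentially. norm (y n / s n) \<le> sqrt (y n ^ 4 / real (M n))"
      using ev0
    proof eventually_elim
      case (elim n)
      have "y n / s n \<le> y n ^ 2 / s n"
        using elim by (intro divide_right_mono) (auto simp: power2_eq_square)
      also have "\<dots> = sqrt (y n ^ 4 / real (M n))"
        by (simp add: real_sqrt_divide s_def) (metis power2_abs power_mult_numeral real_sqrt_abs abs_power2 num_double)
      finally show ?case using elim by simp
    qed
    show "(\<lambda>n. sqrt (y n ^ 4 / real (M n))) \<longlonglongrightarrow> 0"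
      using tendsto_real_sqrt[OF y4] by simp
  qed
  \<comment> \<open>The Gaussian factors agree only if the difference of the squares vanishes, not
    merely if the ratio tends to 1. Since \<open>v\<close> exceeds \<open>y\<close> by at most
    \<open>2 / s\<close>, this reduces to \<open>y / s\<close> vanishing.\<close>
  have sq: "(\<lambda>n. v n ^ 2 - y n ^ 2) \<longlonglongrightarrow> 0"
  proof (rule Lim_null_comparison)
    show "\<forall>\<^sub>F n in sequentially. norm (v n ^ 2 - y n ^ 2) \<le> 4 * (y n / s n) + 4 * (1 / s n) * (1 / s n)"
      using ev0
    proof eventually_elim
      case (elim n)
      have "v n ^ 2 \<le> (y n + 2 * (1 / s n)) ^ 2" "y n ^ 2 \<le> v n ^ 2"
        using vy[OF elim] elim by (auto intro!: power_mono)
      thus ?case by (simp add: power2_eq_square algebra_simps)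
    qed
    have "(\<lambda>n. 4 * (y n / s n) + 4 * (1 / s n) * (1 / s n)) \<longlonglongrightarrow> 4 * 0 + 4 * 0 * 0"
      by (intro tendsto_intros ys s_inv)
    thus "(\<lambda>n. 4 * (y n / s n) + 4 * (1 / s n) * (1 / s n)) \<longlonglongrightarrow> 0" by simp
  qed
  have "(\<lambda>n. sym_binom_tail (M n) (k n) * v n * sqrt (2 * pi) * exp (v n ^ 2 / 2)) \<longlonglongrightarrow> 1"
    unfolding v_def by (rule sym_binom_tail_asymp[OF M]) (use v v4 in \<open>simp_all add: v_def\<close>)
  hence "(\<lambda>n. sym_binom_tail (M n) (k n) * v n * sqrt (2 * pi) * exp (v n ^ 2 / 2) / (v n / y n) * exp (- (v n ^ 2 - y n ^ 2) / 2))
         \<longlonglongrightarrow> 1 / 1 * exp (- 0 / 2)"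
    by (intro tendsto_intros ratio sq) auto
  hence "(\<lambda>n. sym_binom_tail (M n) (k n) * v n * sqrt (2 * pi) * exp (v n ^ 2 / 2) / (v n / y n) * exp (- (v n ^ 2 - y n ^ 2) / 2)) \<longlonglongrightarrow> 1"
    by simp
  thus ?thesis
  proof (rule Lim_transform_eventually)
    show "\<forall>\<^sub>F n in sequentially. sym_binom_tail (M n) (k n) * v n * sqrt (2 * pi) * exp (v n ^ 2 / 2) / (v n / y n) * exp (- (v n ^ 2 - y n ^ 2) / 2)
       = measure_pmf.prob (binomial_pmf (M n) (1/2)) {b. real b > real (M n) / 2 + a n} * y n * sqrt (2 * pi) * exp (y n ^ 2 / 2)"
      using ev0
    proof eventually_elim
      case (elim n)
      have "a n > 0" using elim by (simp add: ya)
      hence "measure_pmf.prob (binomial_pmf (M n) (1/2)) {b. real b > real (M n) / 2 + a n} = sym_binom_tail (M n) (k n)"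
        by (subst prob_binomial_half_greater) (auto simp: k_def)
      moreover have "exp (y n ^ 2 / 2) = exp (v n ^ 2 / 2) * exp (- (v n ^ 2 - y n ^ 2) / 2)"
        by (simp add: exp_add[symmetric] field_simps)
      ultimately show ?case using elim vy[OF elim] by simp
    qed
  qed
qed

section \<open>The score of one player\<close>

lemma x_n_at_top: "filterlim (\<lambda>n. x_n n t) at_top sequentially"
  unfolding x_n_def a_n_def b_n_def by real_asymp

text \<open>This explains the form of \<open>b_n\<close>. With \<open>s = sqrt (2 * ln n)\<close>
  the threshold is \<open>s + d\<close>, where
  \<open>s * d = t - (ln (ln n) + ln (4 * pi)) / 2\<close> and \<open>d\<close> vanishes. In the
  exponent \<open>s^2 / 2\<close> cancels the factor \<open>n\<close>, and the logarithmic
  correction produces \<open>sqrt (2 * pi) * s\<close>, which cancels the denominator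
  asymptotically.\<close>

lemma gaussian_tail_at_x_n:
  "(\<lambda>n. real n * exp (- (x_n n t ^ 2) / 2) / (x_n n t * sqrt (2 * pi))) \<longlonglongrightarrow> exp (- t)"
proof -
  define s where "s = (\<lambda>n. sqrt (2 * ln (real n)))"
  define d where "d = (\<lambda>n. (t - (ln (ln (real n)) + ln (4 * pi)) / 2) / s n)"
  have "d \<longlonglongrightarrow> 0"
    unfolding d_def s_def by real_asymp
  moreover have "(\<lambda>n. s n / x_n n t) \<longlonglongrightarrow> 1"
    unfolding s_def x_n_def a_n_def b_n_def by real_asymp
  ultimately have "(\<lambda>n. exp (- t) * (s n / x_n n t) * exp (- (d n ^ 2) / 2)) \<longlonglongrightarrow> exp (- t) * 1 * exp (- (0 ^ 2) / 2)"
    by (intro tendsto_intros) auto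
  hence "(\<lambda>n. exp (- t) * (s n / x_n n t) * exp (- (d n ^ 2) / 2)) \<longlonglongrightarrow> exp (- t)"
    by simp
  thus ?thesis
  proof (rule Lim_transform_eventually)
    show "\<forall>\<^sub>F n in sequentially. exp (- t) * (s n / x_n n t) * exp (- (d n ^ 2) / 2) =
            real n * exp (- (x_n n t ^ 2) / 2) / (x_n n t * sqrt (2 * pi))"
      using eventually_gt_at_top[of 1]
    proof eventually_elim
      case (elim n)
      define w where "w = ln (ln (real n)) + ln (4 * pi)"
      have ln: "ln (real n) > 0" and s: "s n > 0" "s n ^ 2 = 2 * ln (real n)"
        using elim by (auto simp: s_def)
      have s_alt: "sqrt (2 * ln (real n)) = s n" by (simp add: s_def)
      have x: "x_n n t = s n + d n"
        unfolding x_n_def a_n_def b_n_def d_def s_alt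
        using s by (simp add: diff_divide_distrib)
      have sd: "s n * d n = t - w / 2"
        using s by (simp add: d_def w_def)
      have "x_n n t ^ 2 = s n ^ 2 + 2 * (s n * d n) + d n ^ 2"
        unfolding x by (simp add: power2_eq_square algebra_simps)
      hence eq: "- (x_n n t ^ 2) / 2 = - ln (real n) + (- t) + w / 2 + (- (d n ^ 2) / 2)"
        unfolding sd s by (simp add: field_simps)
      have "exp (w / 2) = sqrt (exp w)"
        by (rule real_sqrt_unique[symmetric]) (auto simp: exp_add[symmetric] power2_eq_square)
      also have "exp w = 2 * pi * s n ^ 2"
        using ln by (simp add: w_def exp_add s)
      also have "sqrt (2 * pi * s n ^ 2) = sqrt (2 * pi) * s n"
        using s(1) by (simp add: real_sqrt_mult)
      finally have "real n * exp (- (x_n n t ^ 2) / 2) = exp (- t) * (sqrt (2 * pi) * s n) * exp (- (d n ^ 2) / 2)"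
        unfolding eq exp_add using elim by (simp add: exp_minus)
      thus ?case by simp
    qed
  qed
qed

text \<open>The first limit serves the fourth-power condition of the tail asymptotics; the third
  makes a deviation of \<open>n powr (3/4)\<close> in the number of decisive games invisible in the
  squared threshold.\<close>

lemma x_n_growth:
  "(\<lambda>n. x_n n t ^ 2 / sqrt (real n)) \<longlonglongrightarrow> 0"
  "(\<lambda>n. x_n n t / sqrt (real n)) \<longlonglongrightarrow> 0"
  "(\<lambda>n. x_n n t ^ 2 * (real n powr (3/4) + C) / real n) \<longlonglongrightarrow> 0"
  unfolding x_n_def a_n_def b_n_def by real_asymp+

text \<open>\<open>M\<close> runs through typical numbers of decisive games. Both \<open>M\<close>
  and \<open>4 * sigma_n^2\<close> are close to \<open>n * (1 - p)\<close>, so the standardised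
  threshold \<open>y\<close> satisfies \<open>y^2 - x^2 \<rightarrow> 0\<close>, and the tail at
  \<open>y\<close> can be compared with the Gaussian one at \<open>x\<close>. The bounded shift
  \<open>c\<close> disappears in the same limit.\<close>

lemma binomial_half_tail_x_n:
  fixes M :: "nat \<Rightarrow> nat"
  assumes p: "0 \<le> p" "p < 1"
    and M: "\<forall>\<^sub>F n in sequentially. \<bar>real (M n) - real n * (1 - p)\<bar> \<le> real n powr (3/4) + C"
  shows "(\<lambda>n. real n * measure_pmf.prob (binomial_pmf (M n) (1/2))
            {b. real b > real (M n) / 2 + (x_n n t * sigma_n n p + c)}) \<longlonglongrightarrow> exp (- t)"
proof -
  define g where "g = (\<lambda>n. real n * (1 - p))"
  define x where "x = (\<lambda>n. x_n n t)"
  define a where "a = (\<lambda>n. x n * sigma_n n p + c)"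
  define y where "y = (\<lambda>n. 2 * a n / sqrt (real (M n)))"
  have sigma: "4 * sigma_n n p ^ 2 = g n - (1 - p)" if "n > 0" for n
  proof -
    have "(real n - 1) * (1 - p) / 4 \<ge> 0" using that p by simp
    hence "4 * sigma_n n p ^ 2 = (real n - 1) * (1 - p)" by (simp add: sigma_n_def)
    thus ?thesis by (simp add: g_def algebra_simps)
  qed
  have sigma_at_top: "filterlim (\<lambda>n. sigma_n n p) at_top sequentially"
    unfolding sigma_n_def using p by real_asymp
  have x_top: "filterlim x at_top sequentially"
    unfolding x_def by (rule x_n_at_top)
  have x_inv: "(\<lambda>n. 1 / x n) \<longlonglongrightarrow> 0"
    by (rule real_tendsto_divide_at_top[OF tendsto_const x_top])
  have Mg: "(\<lambda>n. real (M n) / g n) \<longlonglongrightarrow> 1"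
  proof -
    have "(\<lambda>n. real (M n) / g n - 1) \<longlonglongrightarrow> 0"
    proof (rule Lim_null_comparison)
      show "\<forall>\<^sub>F n in sequentially. norm (real (M n) / g n - 1) \<le> (real n powr (3/4) + C) / real n / (1 - p)"
        using M eventually_gt_at_top[of 0]
      proof eventually_elim
        case (elim n)
        have "real (M n) / g n - 1 = (real (M n) - real n * (1 - p)) / g n"
          using elim p by (simp add: g_def field_simps)
        hence "norm (real (M n) / g n - 1) = \<bar>real (M n) - real n * (1 - p)\<bar> / g n"
          using elim p by (simp add: g_def)
        also have "\<dots> \<le> (real n powr (3/4) + C) / g n"
          using elim p by (intro divide_right_mono) (auto simp: g_def)
        finally show ?case by (simp add: g_def)
      qed
      have "(\<lambda>n. (real n powr (3/4) + C) / real n) \<longlonglongrightarrow> 0" by real_asymp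
      from tendsto_divide[OF this tendsto_const[of "1 - p"]] p
      show "(\<lambda>n. (real n powr (3/4) + C) / real n / (1 - p)) \<longlonglongrightarrow> 0" by simp
    qed
    thus ?thesis by (simp add: LIM_zero_iff)
  qed
  have g_top: "filterlim g at_top sequentially"
    unfolding g_def using p by real_asymp
  have M_top: "filterlim M at_top sequentially"
  proof -
    have "filterlim (\<lambda>n. real (M n) / g n * g n) at_top sequentially"
      by (rule filterlim_tendsto_pos_mult_at_top[OF Mg _ g_top]) auto
    moreover have "\<forall>\<^sub>F n in sequentially. real (M n) / g n * g n = real (M n)"
      using eventually_gt_at_top[of 0] by eventually_elim (use p in \<open>simp add: g_def\<close>)
    ultimately show ?thesis
      unfolding filterlim_sequentially_iff_filterlim_real
      by (rule filterlim_mono_eventually[OF _ order_refl order_refl])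
  qed
  have ev: "\<forall>\<^sub>F n in sequentially. x n > 0 \<and> M n > 0 \<and> a n > 0 \<and> n > 0"
  proof -
    have "filterlim a at_top sequentially"
      unfolding a_def add.commute[of _ c]
      by (intro filterlim_tendsto_add_at_top[OF tendsto_const] filterlim_at_top_mult_at_top x_top sigma_at_top)
    hence "\<forall>\<^sub>F n in sequentially. a n > 0" by (simp add: filterlim_at_top_dense)
    moreover have "\<forall>\<^sub>F n in sequentially. x n > 0"
      using x_top by (simp add: filterlim_at_top_dense)
    moreover have "\<forall>\<^sub>F n in sequentially. M n > 0"
      using M_top unfolding filterlim_at_top by (auto simp: Suc_le_eq dest: spec[of _ 1])
    ultimately show ?thesis using eventually_gt_at_top[of 0] by eventually_elim auto
  qed
  have gM: "(\<lambda>n. g n / real (M n)) \<longlonglongrightarrow> 1"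
    using tendsto_divide[OF tendsto_const[of 1] Mg] by simp
  \<comment> \<open>The three summands isolate the deviation of \<open>M\<close> from
    \<open>4 * sigma_n^2\<close>, the cross term with the shift, and the squared shift.\<close>
  have y2_eq: "y n ^ 2 - x n ^ 2 = (g n / real (M n)) *
      (x n ^ 2 * (g n - (1 - p) - real (M n)) / g n + 8 * c * (x n * sigma_n n p / g n) + 4 * c ^ 2 / g n)"
    if "M n > 0" "n > 0" for n
  proof -
    have g: "g n > 0" using that p by (simp add: g_def)
    have "y n ^ 2 = 4 * (a n) ^ 2 / real (M n)"
      using that by (simp add: y_def power_divide power_mult_distrib)
    also have "4 * (a n) ^ 2 = x n ^ 2 * (4 * sigma_n n p ^ 2) + 8 * c * (x n * sigma_n n p) + 4 * c ^ 2"
      by (simp add: a_def power2_eq_square algebra_simps)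
    finally have "y n ^ 2 = (x n ^ 2 * (g n - (1 - p)) + 8 * c * (x n * sigma_n n p) + 4 * c ^ 2) / real (M n)"
      using sigma[of n] that by simp
    hence "y n ^ 2 - x n ^ 2 = (x n ^ 2 * (g n - (1 - p) - real (M n)) + 8 * c * (x n * sigma_n n p) + 4 * c ^ 2) / real (M n)"
      using that by (simp add: field_simps)
    also have "\<dots> = (g n / real (M n)) *
      ((x n ^ 2 * (g n - (1 - p) - real (M n)) + 8 * c * (x n * sigma_n n p) + 4 * c ^ 2) / g n)"
      using g by simp
    finally show ?thesis by (simp add: add_divide_distrib)
  qed
  \<comment> \<open>In the bound, \<open>C + 1\<close> absorbs the extra \<open>1 - p\<close>, which
    stems from the \<open>n - 1\<close> in \<open>sigma_n\<close>.\<close>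
  have lim1: "(\<lambda>n. x n ^ 2 * (g n - (1 - p) - real (M n)) / g n) \<longlonglongrightarrow> 0"
  proof (rule Lim_null_comparison)
    show "\<forall>\<^sub>F n in sequentially. norm (x n ^ 2 * (g n - (1 - p) - real (M n)) / g n) \<le>
            x n ^ 2 * (real n powr (3/4) + (C + 1)) / real n / (1 - p)"
      using M ev
    proof eventually_elim
      case (elim n)
      hence g: "g n > 0" using p by (simp add: g_def)
      have "norm (x n ^ 2 * (g n - (1 - p) - real (M n)) / g n) = x n ^ 2 * \<bar>g n - (1 - p) - real (M n)\<bar> / g n"
        using g by (simp add: abs_mult)
      also have "\<dots> \<le> x n ^ 2 * (real n powr (3/4) + (C + 1)) / g n"
        using g elim p by (intro divide_right_mono mult_left_mono) (auto simp: g_def abs_le_iff)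
      finally show ?case by (simp add: g_def)
    qed
    from tendsto_divide[OF x_n_growth(3)[of t "C + 1"] tendsto_const[of "1 - p"]] p
    show "(\<lambda>n. x n ^ 2 * (real n powr (3/4) + (C + 1)) / real n / (1 - p)) \<longlonglongrightarrow> 0"
      by (simp add: x_def)
  qed
  have lim2: "(\<lambda>n. x n * sigma_n n p / g n) \<longlonglongrightarrow> 0"
  proof -
    have "(\<lambda>n. sigma_n n p / sqrt (real n)) \<longlonglongrightarrow> ((1 - p) / 4) powr (1 / 2)"
      unfolding sigma_n_def using p by real_asymp
    from tendsto_divide[OF tendsto_mult[OF x_n_growth(2)[of t] this] tendsto_const[of "1 - p"]] p
    have "(\<lambda>n. x n / sqrt (real n) * (sigma_n n p / sqrt (real n)) / (1 - p)) \<longlonglongrightarrow> 0"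
      by (simp add: x_def)
    thus ?thesis by (simp add: g_def)
  qed
  have lim3: "(\<lambda>n. 4 * c ^ 2 / g n) \<longlonglongrightarrow> 0"
    by (rule real_tendsto_divide_at_top[OF tendsto_const g_top])
  have sq: "(\<lambda>n. y n ^ 2 - x n ^ 2) \<longlonglongrightarrow> 0"
  proof -
    have "(\<lambda>n. (g n / real (M n)) *
      (x n ^ 2 * (g n - (1 - p) - real (M n)) / g n + 8 * c * (x n * sigma_n n p / g n) + 4 * c ^ 2 / g n))
       \<longlonglongrightarrow> 1 * (0 + 8 * c * 0 + 0)"
      by (intro tendsto_intros gM lim1 lim2 lim3)
    hence "(\<lambda>n. (g n / real (M n)) *
      (x n ^ 2 * (g n - (1 - p) - real (M n)) / g n + 8 * c * (x n * sigma_n n p / g n) + 4 * c ^ 2 / g n)) \<longlonglongrightarrow> 0"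
      by simp
    thus ?thesis
    proof (rule Lim_transform_eventually)
      show "\<forall>\<^sub>F n in sequentially. (g n / real (M n)) *
        (x n ^ 2 * (g n - (1 - p) - real (M n)) / g n + 8 * c * (x n * sigma_n n p / g n) + 4 * c ^ 2 / g n) = y n ^ 2 - x n ^ 2"
        using ev by eventually_elim (simp add: y2_eq)
    qed
  qed
  have y_pos: "\<forall>\<^sub>F n in sequentially. y n > 0"
    using ev by eventually_elim (simp add: y_def)
  have y_top: "filterlim y at_top sequentially"
  proof -
    have "filterlim (\<lambda>n. (y n ^ 2 - x n ^ 2) + x n ^ 2) at_top sequentially"
      by (rule filterlim_tendsto_add_at_top[OF sq])
         (rule filterlim_pow_at_top[OF _ x_top], simp)
    hence "filterlim (\<lambda>n. sqrt (y n ^ 2)) at_top sequentially"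
      by (intro filterlim_compose[OF sqrt_at_top]) simp
    thus ?thesis
      by (rule filterlim_mono_eventually) (use y_pos in \<open>auto elim!: eventually_mono\<close>)
  qed
  have yx: "(\<lambda>n. y n / x n) \<longlonglongrightarrow> 1"
  proof -
    have "(\<lambda>n. sqrt (1 + (y n ^ 2 - x n ^ 2) * (1 / x n) * (1 / x n))) \<longlonglongrightarrow> sqrt (1 + 0 * 0 * 0)"
      by (intro tendsto_intros sq x_inv)
    hence "(\<lambda>n. sqrt (1 + (y n ^ 2 - x n ^ 2) * (1 / x n) * (1 / x n))) \<longlonglongrightarrow> 1" by simp
    thus ?thesis
    proof (rule Lim_transform_eventually)
      show "\<forall>\<^sub>F n in sequentially. sqrt (1 + (y n ^ 2 - x n ^ 2) * (1 / x n) * (1 / x n)) = y n / x n"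
        using ev y_pos
      proof eventually_elim
        case (elim n)
        have "1 + (y n ^ 2 - x n ^ 2) * (1 / x n) * (1 / x n) = (y n / x n) ^ 2"
          using elim by (simp add: power2_eq_square field_simps)
        thus ?case using elim by simp
      qed
    qed
  qed
  have y4: "(\<lambda>n. y n ^ 4 / real (M n)) \<longlonglongrightarrow> 0"
  proof -
    have "(\<lambda>n. (g n / real (M n)) * ((y n / x n) ^ 4 * (x n ^ 2 / sqrt (real n)) ^ 2 / (1 - p))) \<longlonglongrightarrow> 1 * (1 ^ 4 * 0 ^ 2 / (1 - p))"
      using p by (intro tendsto_intros gM yx x_n_growth(1)[of t, folded x_def]) (auto simp: x_def intro: x_n_growth)
    hence "(\<lambda>n. (g n / real (M n)) * ((y n / x n) ^ 4 * (x n ^ 2 / sqrt (real n)) ^ 2 / (1 - p))) \<longlonglongrightarrow> 0"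
      by simp
    thus ?thesis
    proof (rule Lim_transform_eventually)
      show "\<forall>\<^sub>F n in sequentially. (g n / real (M n)) * ((y n / x n) ^ 4 * (x n ^ 2 / sqrt (real n)) ^ 2 / (1 - p)) = y n ^ 4 / real (M n)"
        using ev
      proof eventually_elim
        case (elim n)
        have "(y n / x n) ^ 4 * (x n ^ 2 / sqrt (real n)) ^ 2 = y n ^ 4 / real n"
          using elim by (simp add: power_divide)
        thus ?case using elim p by (simp add: g_def)
      qed
    qed
  qed
  \<comment> \<open>The three exponentials multiply to 1 and the factors in \<open>y\<close> and
    \<open>x\<close> cancel, leaving \<open>n\<close> times the tail probability.\<close>
  have "(\<lambda>n. (measure_pmf.prob (binomial_pmf (M n) (1/2)) {b. real b > real (M n) / 2 + a n} *
             y n * sqrt (2 * pi) * exp (y n ^ 2 / 2)) *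
             (real n * exp (- (x n ^ 2) / 2) / (x n * sqrt (2 * pi))) / (y n / x n) * exp (- ((y n ^ 2 - x n ^ 2) / 2)))
           \<longlonglongrightarrow> 1 * exp (- t) / 1 * exp (- (0 / 2))"
    unfolding y_def
    by (intro tendsto_mult tendsto_divide tendsto_exp tendsto_minus binomial_half_tail_asymp M_top tendsto_const)
       (use y_top y4 yx sq gaussian_tail_at_x_n[of t] in \<open>auto simp: y_def x_def\<close>)
  hence "(\<lambda>n. (measure_pmf.prob (binomial_pmf (M n) (1/2)) {b. real b > real (M n) / 2 + a n} *
             y n * sqrt (2 * pi) * exp (y n ^ 2 / 2)) *
             (real n * exp (- (x n ^ 2) / 2) / (x n * sqrt (2 * pi))) / (y n / x n) * exp (- ((y n ^ 2 - x n ^ 2) / 2)))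
           \<longlonglongrightarrow> exp (- t)"
    by simp
  hence "(\<lambda>n. real n * measure_pmf.prob (binomial_pmf (M n) (1/2)) {b. real b > real (M n) / 2 + a n}) \<longlonglongrightarrow> exp (- t)"
  proof (rule Lim_transform_eventually)
    show "\<forall>\<^sub>F n in sequentially. (measure_pmf.prob (binomial_pmf (M n) (1/2)) {b. real b > real (M n) / 2 + a n} *
             y n * sqrt (2 * pi) * exp (y n ^ 2 / 2)) *
             (real n * exp (- (x n ^ 2) / 2) / (x n * sqrt (2 * pi))) / (y n / x n) * exp (- ((y n ^ 2 - x n ^ 2) / 2))
        = real n * measure_pmf.prob (binomial_pmf (M n) (1/2)) {b. real b > real (M n) / 2 + a n}"
      using ev y_pos
    proof eventually_elim
      case (elim n)
      have cancel: "P * y n * r * e1 * (N * e2 / (x n * r)) / (y n / x n) * e3 = N * P * (e1 * e2 * e3)" if "r > 0" for P r e1 e2 e3 N :: real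
        using elim that by (simp add: field_simps)
      have "exp (y n ^ 2 / 2) * exp (- (x n ^ 2) / 2) * exp (- ((y n ^ 2 - x n ^ 2) / 2)) = 1"
        unfolding exp_add[symmetric] by (simp add: field_simps)
      thus ?case by (subst cancel) auto
    qed
  qed
  thus ?thesis by (simp add: a_def x_def)
qed

section \<open>Sums of independent game scores\<close>

primrec game_sum :: "real \<Rightarrow> nat \<Rightarrow> real pmf" where
  "game_sum p 0 = return_pmf 0"
| "game_sum p (Suc N) = bind_pmf (game_pmf p) (\<lambda>x. map_pmf ((+) x) (game_sum p N))"

lemma bernoulli_pmf_complement:
  assumes "p \<in> {0..1}"
  shows "map_pmf Not (bernoulli_pmf p) = bernoulli_pmf (1 - p)"
proof (rule pmf_eqI)
  fix b
  have "pmf (map_pmf Not (bernoulli_pmf p)) (Not (\<not> b)) = pmf (bernoulli_pmf p) (\<not> b)"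
    by (rule pmf_map_inj') (auto simp: inj_def)
  thus "pmf (map_pmf Not (bernoulli_pmf p)) b = pmf (bernoulli_pmf (1 - p)) b"
    using assms by (cases b) auto
qed

text \<open>With success meaning a decisive game, the outer coin matches the recursion of the
  binomial law for the number of decisive games.\<close>

lemma game_pmf_decisive:
  assumes "p \<in> {0..1}"
  shows "game_pmf p = bind_pmf (bernoulli_pmf (1 - p))
     (\<lambda>d. if d then map_pmf (\<lambda>b. if b then 1 else 0) (bernoulli_pmf (1/2)) else return_pmf (1/2))"
  unfolding bernoulli_pmf_complement[OF assms, symmetric] game_pmf_def bind_map_pmf
  by (intro bind_pmf_cong) auto

text \<open>The inner coin is fair, so exchanging win and loss keeps the law, and a draw is fixed.
  This matters because only the score of the lower-numbered player is stored; the opponent reads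
  \<open>1 - x\<close>.\<close>

lemma game_pmf_reflect:
  "map_pmf (\<lambda>x. 1 - x) (game_pmf p) = game_pmf p"
proof -
  have "map_pmf (\<lambda>b. if b then 0 else (1::real)) (bernoulli_pmf (1/2))
      = map_pmf (\<lambda>b. if b then 1 else 0) (map_pmf Not (bernoulli_pmf (1/2)))"
    by (auto simp: pmf.map_comp o_def intro!: map_pmf_cong)
  also have "map_pmf Not (bernoulli_pmf (1/2)) = bernoulli_pmf (1/2)"
    by (subst bernoulli_pmf_complement) auto
  finally have flip: "map_pmf (\<lambda>b. if b then 0 else (1::real)) (bernoulli_pmf (1/2))
      = map_pmf (\<lambda>b. if b then 1 else 0) (bernoulli_pmf (1/2))" .
  have "map_pmf (\<lambda>x. 1 - x) (map_pmf (\<lambda>b. if b then 1 else (0::real)) (bernoulli_pmf (1/2))) =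
      map_pmf (\<lambda>b. if b then 0 else (1::real)) (bernoulli_pmf (1/2))"
    by (auto simp: pmf.map_comp o_def intro!: map_pmf_cong)
  thus ?thesis
    unfolding game_pmf_def map_bind_pmf by (intro bind_pmf_cong) (auto simp: flip)
qed

lemma set_game_pmf: "set_pmf (game_pmf p) \<subseteq> {0..1}"
  by (auto simp: game_pmf_def split: if_splits)

text \<open>Conditioning on the number \<open>D\<close> of decisive games reduces everything to symmetric
  binomials, since the remaining \<open>N - D\<close> games contribute \<open>1/2\<close> each.\<close>
lemma game_sum_eq_binomial:
  assumes "p \<in> {0..1}"
  shows "game_sum p N = bind_pmf (binomial_pmf N (1 - p))
           (\<lambda>D. map_pmf (\<lambda>b. (real N - real D) / 2 + real b) (binomial_pmf D (1/2)))"
proof (induction N)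
  case 0
  show ?case using assms by (simp add: binomial_pmf_0 bind_return_pmf)
next
  case (Suc N)
  define F where "F = (\<lambda>(x::real) D. map_pmf (\<lambda>b. x + ((real N - real D) / 2 + real b)) (binomial_pmf D (1/2)))"
  have "game_sum p (Suc N) = bind_pmf (game_pmf p) (\<lambda>x. bind_pmf (binomial_pmf N (1 - p)) (F x))"
    by (simp add: Suc.IH map_bind_pmf pmf.map_comp o_def F_def)
  also have "\<dots> = bind_pmf (bernoulli_pmf (1 - p)) (\<lambda>d. bind_pmf (binomial_pmf N (1 - p)) (\<lambda>D.
      if d then bind_pmf (bernoulli_pmf (1/2)) (\<lambda>b. F (if b then 1 else 0) D) else F (1/2) D))"
    unfolding game_pmf_decisive[OF assms] bind_assoc_pmf
    by (intro bind_pmf_cong refl) (auto simp: bind_map_pmf bind_return_pmf intro: bind_commute_pmf)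
  \<comment> \<open>A decisive first game is one more fair trial and raises \<open>D\<close> by one;
    a draw keeps \<open>D\<close> and adds \<open>1/2\<close> to the offset. Both agree with the
    formula for \<open>Suc N\<close> games and the updated count.\<close>
  also have "\<dots> = bind_pmf (bernoulli_pmf (1 - p)) (\<lambda>d. bind_pmf (binomial_pmf N (1 - p)) (\<lambda>D.
       map_pmf (\<lambda>b. (real (Suc N) - real ((if d then 1 else 0) + D)) / 2 + real b)
         (binomial_pmf ((if d then 1 else 0) + D) (1/2))))"
  proof (intro bind_pmf_cong refl, goal_cases)
    case (1 d D)
    show ?case
    proof (cases d)
      case True
      thus ?thesis
        by (simp add: binomial_pmf_Suc F_def map_bind_pmf map_pmf_def bind_assoc_pmf bind_return_pmf)
           (auto intro!: bind_pmf_cong simp: field_simps)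
    next
      case False
      thus ?thesis by (auto simp: F_def field_simps intro!: map_pmf_cong)
    qed
  qed
  also have "\<dots> = bind_pmf (binomial_pmf (Suc N) (1 - p))
           (\<lambda>D. map_pmf (\<lambda>b. (real (Suc N) - real D) / 2 + real b) (binomial_pmf D (1/2)))"
    using assms by (subst binomial_pmf_Suc) (auto simp: bind_assoc_pmf bind_return_pmf)
  finally show ?case .
qed

lemma prob_bind_pmf:
  "measure_pmf.prob (bind_pmf M f) A = measure_pmf.expectation M (\<lambda>x. measure_pmf.prob (f x) A)"
proof -
  have "ennreal (measure_pmf.prob (bind_pmf M f) A) = (\<integral>\<^sup>+x. ennreal (measure_pmf.prob (f x) A) \<partial>measure_pmf M)"
    by (simp add: measure_pmf.emeasure_eq_measure[symmetric])
  also have "\<dots> = ennreal (measure_pmf.expectation M (\<lambda>x. measure_pmf.prob (f x) A))"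
    by (intro nn_integral_eq_integral measure_pmf.integrable_const_bound[where B = 1]) auto
  finally show ?thesis
    by (subst (asm) ennreal_inj) (auto intro!: integral_nonneg_AE)
qed

text \<open>The offset \<open>(N - D) / 2\<close> turns \<open>N / 2\<close> into
  \<open>D / 2\<close>, so the distance \<open>a\<close> from the mean is the same for every
  \<open>D\<close>.\<close>

lemma prob_game_sum_greater:
  assumes "p \<in> {0..1}"
  shows "measure_pmf.prob (game_sum p N) {s. s > real N / 2 + a} =
     measure_pmf.expectation (binomial_pmf N (1 - p))
       (\<lambda>D. measure_pmf.prob (binomial_pmf D (1/2)) {b. real b > real D / 2 + a})"
  unfolding game_sum_eq_binomial[OF assms] prob_bind_pmf measure_map_pmf
  by (intro Bochner_Integration.integral_cong refl arg_cong2[of _ _ _ _ measure_pmf.prob])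
     (auto simp: field_simps)

text \<open>Choosing from each \<open>G n\<close> a violator whenever there is one reduces
  uniformity to a single sequence. Limits along sequences thus become a bound that can be averaged
  over \<open>D\<close>.\<close>

lemma eventually_uniform_if_sequences:
  fixes f :: "nat \<Rightarrow> 'a \<Rightarrow> real"
  assumes seq: "\<And>M. (\<And>n. M n \<in> G n) \<Longrightarrow> (\<lambda>n. f n (M n)) \<longlonglongrightarrow> l"
    and ne: "\<And>n. G n \<noteq> {}" and "\<epsilon> > 0"
  shows "\<forall>\<^sub>F n in sequentially. \<forall>D\<in>G n. \<bar>f n D - l\<bar> < \<epsilon>"
proof -
  have "\<exists>D\<in>G n. (\<exists>D'\<in>G n. \<bar>f n D' - l\<bar> \<ge> \<epsilon>) \<longrightarrow> \<bar>f n D - l\<bar> \<ge> \<epsilon>" for n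
    using ne[of n] by blast
  then obtain M where M: "\<And>n. M n \<in> G n"
      "\<And>n. (\<exists>D'\<in>G n. \<bar>f n D' - l\<bar> \<ge> \<epsilon>) \<Longrightarrow> \<bar>f n (M n) - l\<bar> \<ge> \<epsilon>"
    by metis
  have "\<forall>\<^sub>F n in sequentially. dist (f n (M n)) l < \<epsilon>"
    using seq[OF M(1)] \<open>\<epsilon> > 0\<close> by (rule tendstoD)
  thus ?thesis
    by eventually_elim (use M(2) in \<open>force simp: dist_real_def not_less\<close>)
qed

text \<open>The conditional tail is averaged over \<open>D\<close>: convergence is uniform on the
  window \<open>G n\<close>, and Hoeffding's bound outside it beats the factor \<open>n\<close>.
  That the limit depends on neither \<open>m\<close> nor \<open>c\<close> is what allows the games
  inside a set of players to be ignored.\<close>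

lemma game_sum_tail_x_n:
  assumes p: "0 \<le> p" "p < 1"
  shows "(\<lambda>n. real n * measure_pmf.prob (game_sum p (n - m))
            {s. s > (real n - 1) / 2 + x_n n t * sigma_n n p + c}) \<longlonglongrightarrow> exp (- t)"
proof -
  \<comment> \<open>Recentring from \<open>(n - 1) / 2\<close> to \<open>(n - m) / 2\<close> costs
    \<open>(m - 1) / 2\<close>.\<close>
  define d where "d = (real m - 1) / 2 + c"
  define f where "f = (\<lambda>n D. real n * measure_pmf.prob (binomial_pmf D (1/2))
      {b. real b > real D / 2 + (x_n n t * sigma_n n p + d)})"
  \<comment> \<open>The exponent \<open>3/4\<close> is large enough for Hoeffding's bound to give
    \<open>exp (- 2 * sqrt n)\<close> and small enough for \<open>x_n_growth\<close>. The term
    \<open>m + 1\<close> covers the change of the mean from \<open>n - m\<close> to \<open>n\<close>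
    trials and the rounding in \<open>G_ne\<close>.\<close>
  define G where "G = (\<lambda>n. {D. \<bar>real D - real n * (1 - p)\<bar> \<le> real n powr (3/4) + (real m + 1)})"
  define bad where "bad = (\<lambda>n. measure_pmf.prob (binomial_pmf (n - m) (1 - p)) (- G n))"
  have G_ne: "G n \<noteq> {}" for n
  proof -
    have "0 \<le> real n powr (3/4)" "0 \<le> real n * (1 - p)" using p by auto
    hence "nat \<lfloor>real n * (1 - p)\<rfloor> \<in> G n"
      unfolding G_def mem_Collect_eq by linarith
    thus ?thesis by blast
  qed
  have unif: "\<forall>\<^sub>F n in sequentially. \<forall>D\<in>G n. \<bar>f n D - exp (- t)\<bar> < \<epsilon>" if "\<epsilon> > 0" for \<epsilon>
  proof (rule eventually_uniform_if_sequences[OF _ G_ne that])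
    fix M assume "\<And>n. M n \<in> G n"
    thus "(\<lambda>n. f n (M n)) \<longlonglongrightarrow> exp (- t)"
      unfolding f_def by (intro binomial_half_tail_x_n[where C = "real m + 1"] p) (auto simp: G_def)
  qed
  \<comment> \<open>Since \<open>f n\<close> lies between 0 and \<open>n\<close>, the weight
    \<open>n + exp (- t)\<close> bounds its distance to the limit outside the window.\<close>
  have bad: "(\<lambda>n. (real n + exp (- t)) * bad n) \<longlonglongrightarrow> 0"
  proof (rule Lim_null_comparison)
    show "\<forall>\<^sub>F n in sequentially. norm ((real n + exp (- t)) * bad n) \<le>
             (real n + exp (- t)) * (2 * exp (- 2 * sqrt (real n)))"
      using eventually_gt_at_top[of m]
    proof eventually_elim
      case (elim n)
      interpret binomial_distribution "n - m" "1 - p"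
        by unfold_locales (use p in auto)
      define e where "e = real n powr (3/4)"
      have e: "e \<ge> 0" "e ^ 2 = real n * sqrt (real n)"
      proof -
        show "e \<ge> 0" by (simp add: e_def)
        have "e ^ 2 = real n powr (3/2)" using elim by (simp add: e_def powr_power)
        also have "3 / 2 = 1 + (1 / 2 :: real)" by simp
        also have "real n powr (1 + 1 / 2) = real n * sqrt (real n)"
          using elim unfolding powr_add by (simp add: powr_half_sqrt)
        finally show "e ^ 2 = real n * sqrt (real n)" .
      qed
      have "bad n \<le> measure_pmf.prob (binomial_pmf (n - m) (1 - p)) {x. \<bar>real x - real (n - m) * (1 - p)\<bar> \<ge> e}"
        unfolding bad_def
      proof (intro measure_pmf.finite_measure_mono subsetI)
        fix D assume "D \<in> - G n"
        hence D: "\<bar>real D - real n * (1 - p)\<bar> > e + (real m + 1)" by (auto simp: G_def e_def)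
        have "real (n - m) * (1 - p) = real n * (1 - p) - real m * (1 - p)"
          using elim by (simp add: of_nat_diff algebra_simps)
        moreover have "0 \<le> real m * (1 - p)" "real m * (1 - p) \<le> real m"
          using p by (auto simp: mult_left_le)
        ultimately show "D \<in> {x. \<bar>real x - real (n - m) * (1 - p)\<bar> \<ge> e}"
          using D by auto
      qed auto
      also have "\<dots> \<le> 2 * exp (- 2 * e ^ 2 / real (n - m))"
        by (rule prob_abs_ge) (use elim e in auto)
      also have "\<dots> \<le> 2 * exp (- 2 * sqrt (real n))"
      proof -
        have "sqrt (real n) * real (n - m) \<le> e ^ 2"
          unfolding e using elim by (simp add: mult.commute mult_left_mono)
        thus ?thesis using elim by (simp add: pos_le_divide_eq)
      qed
      finally show ?case
        by (auto simp: bad_def intro!: mult_left_mono)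
    qed
    show "(\<lambda>n. (real n + exp (- t)) * (2 * exp (- 2 * sqrt (real n)))) \<longlonglongrightarrow> 0"
      by real_asymp
  qed
  have "(\<lambda>n. measure_pmf.expectation (binomial_pmf (n - m) (1 - p)) (f n) - exp (- t)) \<longlonglongrightarrow> 0"
  proof (rule tendstoI)
    fix \<epsilon> :: real assume "\<epsilon> > 0"
    hence "\<epsilon> / 2 > 0" by simp
    have "\<forall>\<^sub>F n in sequentially. (real n + exp (- t)) * bad n < \<epsilon> / 2"
      using bad \<open>\<epsilon> / 2 > 0\<close> by (rule order_tendstoD)
    with unif[OF \<open>\<epsilon> / 2 > 0\<close>]
    show "\<forall>\<^sub>F n in sequentially. dist (measure_pmf.expectation (binomial_pmf (n - m) (1 - p)) (f n) - exp (- t)) 0 < \<epsilon>"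
    proof eventually_elim
      case (elim n)
      let ?B = "binomial_pmf (n - m) (1 - p)"
      have [simp]: "integrable (measure_pmf ?B) h" for h :: "nat \<Rightarrow> real"
        using p by auto
      have bound: "\<bar>f n D - exp (- t)\<bar> \<le> \<epsilon> / 2 + (real n + exp (- t)) * indicator (- G n) D" for D
      proof (cases "D \<in> G n")
        case True
        thus ?thesis using elim by (auto intro: less_imp_le)
      next
        case False
        have "0 \<le> f n D" by (simp add: f_def)
        moreover have "f n D \<le> real n * 1"
          unfolding f_def by (intro mult_left_mono) auto
        moreover have ind: "indicator (- G n) D = (1 :: real)" using False by simp
        ultimately show ?thesis
          unfolding ind mult_1_right using \<open>\<epsilon> > 0\<close> exp_gt_zero[of "- t"] by linarith
      qed
      have "measure_pmf.expectation ?B (f n) - exp (- t) = measure_pmf.expectation ?B (\<lambda>D. f n D - exp (- t))"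
        by simp
      also have "\<bar>\<dots>\<bar> \<le> measure_pmf.expectation ?B (\<lambda>D. \<bar>f n D - exp (- t)\<bar>)"
        by (rule integral_abs_bound)
      also have "\<dots> \<le> measure_pmf.expectation ?B (\<lambda>D. \<epsilon> / 2 + (real n + exp (- t)) * indicator (- G n) D)"
        by (intro integral_mono bound) simp_all
      also have "\<dots> = \<epsilon> / 2 + (real n + exp (- t)) * bad n"
        by (simp add: bad_def)
      also have "\<dots> < \<epsilon>" using elim by simp
      finally show ?case by simp
    qed
  qed
  hence "(\<lambda>n. measure_pmf.expectation (binomial_pmf (n - m) (1 - p)) (f n)) \<longlonglongrightarrow> exp (- t)"
    by (simp add: LIM_zero_iff)
  thus ?thesis
  proof (rule Lim_transform_eventually)
    show "\<forall>\<^sub>F n in sequentially. measure_pmf.expectation (binomial_pmf (n - m) (1 - p)) (f n) =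
       real n * measure_pmf.prob (game_sum p (n - m)) {s. s > (real n - 1) / 2 + x_n n t * sigma_n n p + c}"
      using eventually_gt_at_top[of m]
    proof eventually_elim
      case (elim n)
      have eq: "(real n - 1) / 2 + x_n n t * sigma_n n p + c = real (n - m) / 2 + (x_n n t * sigma_n n p + d)"
        using elim by (simp add: d_def of_nat_diff field_simps)
      thus ?case
        unfolding eq using p by (subst prob_game_sum_greater) (simp_all add: f_def)
    qed
  qed
qed

section \<open>Poisson limits from binomial moments\<close>

text \<open>For positive \<open>r\<close> and \<open>L\<close> the truncated alternating sum
  collapses to \<open>r - 1 choose L - 1\<close> up to sign, which is at most
  \<open>r choose L\<close>.\<close>

lemma alternating_binomial_error:
  "\<bar>of_bool (r = 0) - (\<Sum>j<L. (-1) ^ j * real (r choose j))\<bar> \<le> real (r choose L)"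
proof (cases L; cases r)
  fix L' r' assume L: "L = Suc L'" and r: "r = Suc r'"
  have "(\<Sum>j<Suc L'. (-1) ^ j * real (Suc r' choose j)) = (-1) ^ L' * real (r' choose L')" for L'
    by (induction L') (auto simp: algebra_simps)
  thus ?thesis by (simp add: L r abs_mult)
next
  fix L' assume "L = Suc L'" "r = 0"
  have "(\<Sum>j<Suc L'. (-1) ^ j * real (0 choose j)) = (\<Sum>j\<in>{0}. (-1) ^ j * real (0 choose j))"
    by (rule sum.mono_neutral_right) auto
  thus ?thesis using \<open>L = Suc L'\<close> \<open>r = 0\<close> by simp
qed auto

lemma choose_mult_add: "(k + j choose k) * (s choose (k + j)) = (s choose k) * ((s - k) choose j)"
proof (cases "k + j \<le> s")
  case True
  thus ?thesis using choose_mult[of k "k + j" s] by (simp add: mult.commute)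
next
  case False
  thus ?thesis by (cases "k \<le> s") (auto simp: binomial_eq_0)
qed

text \<open>A Bonferroni estimate: factoring out \<open>s choose k\<close> leaves the alternating
  sum for \<open>s - k\<close>. For \<open>s < k\<close> that factor is zero, so the truncated
  subtraction is harmless.\<close>

lemma inclusion_exclusion_error:
  "\<bar>of_bool (s = k) - (\<Sum>j<L. (-1) ^ j * real (k + j choose k) * real (s choose (k + j)))\<bar>
     \<le> real (k + L choose k) * real (s choose (k + L))"
proof -
  have "(\<Sum>j<L. (-1) ^ j * real (k + j choose k) * real (s choose (k + j))) =
        real (s choose k) * (\<Sum>j<L. (-1) ^ j * real ((s - k) choose j))"
    unfolding sum_distrib_left
    by (intro sum.cong refl) (use choose_mult_add[of k _ s] in \<open>simp flip: of_nat_mult\<close>)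
  moreover have "of_bool (s = k) = real (s choose k) * of_bool (s - k = 0)"
    by (cases "s < k") auto
  ultimately have "\<bar>of_bool (s = k) - (\<Sum>j<L. (-1) ^ j * real (k + j choose k) * real (s choose (k + j)))\<bar> =
      real (s choose k) * \<bar>of_bool (s - k = 0) - (\<Sum>j<L. (-1) ^ j * real ((s - k) choose j))\<bar>"
    by (simp only: right_diff_distrib[symmetric] abs_mult abs_of_nat)
  also have "\<dots> \<le> real (s choose k) * real ((s - k) choose L)"
    by (intro mult_left_mono alternating_binomial_error) auto
  also have "\<dots> = real (k + L choose k) * real (s choose (k + L))"
    by (simp flip: of_nat_mult add: choose_mult_add)
  finally show ?thesis .
qed

text \<open>The truncation level \<open>L\<close> is fixed before \<open>n\<close> grows, so only
  finitely many moments are involved at a time; the truncation error then tends to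
  \<open>b L\<close>, a multiple of a term of the exponential series.\<close>

theorem poisson_limit_of_binomial_moments:
  fixes M :: "nat \<Rightarrow> 'a pmf" and S :: "nat \<Rightarrow> 'a \<Rightarrow> nat" and \<mu> :: real
  assumes int: "\<And>n m. integrable (measure_pmf (M n)) (\<lambda>\<omega>. real (S n \<omega> choose m))"
    and mom: "\<And>m. (\<lambda>n. measure_pmf.expectation (M n) (\<lambda>\<omega>. real (S n \<omega> choose m))) \<longlonglongrightarrow> \<mu> ^ m / fact m"
  shows "(\<lambda>n. measure_pmf.prob (M n) {\<omega>. S n \<omega> = k}) \<longlonglongrightarrow> exp (- \<mu>) * \<mu> ^ k / fact k"
proof -
  define e where "e = (\<lambda>n m. measure_pmf.expectation (M n) (\<lambda>\<omega>. real (S n \<omega> choose m)))"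
  define a where "a = (\<lambda>L. \<Sum>j<L. (-1) ^ j * real (k + j choose k) * (\<mu> ^ (k + j) / fact (k + j)))"
  define b where "b = (\<lambda>L. real (k + L choose k) * (\<mu> ^ (k + L) / fact (k + L)))"
  have choose: "real (k + j choose k) * (\<mu> ^ (k + j) / fact (k + j)) = \<mu> ^ k / fact k * (\<mu> ^ j /\<^sub>R fact j)" for j
    by (simp add: binomial_fact power_add field_simps)
  have b_lim: "b \<longlonglongrightarrow> 0"
    unfolding b_def choose
    using tendsto_mult_right_zero[OF summable_LIMSEQ_zero[OF summable_exp_generic[of \<mu>]]] by simp
  have a_lim: "a \<longlonglongrightarrow> exp (- \<mu>) * \<mu> ^ k / fact k"
  proof -
    have "a = (\<lambda>L. \<mu> ^ k / fact k * (\<Sum>j<L. (- \<mu>) ^ j /\<^sub>R fact j))"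
      unfolding a_def sum_distrib_left
      by (intro ext sum.cong refl, subst mult.assoc, subst choose) (auto simp: power_minus[of \<mu>])
    moreover have "(\<lambda>L. \<Sum>j<L. (- \<mu>) ^ j /\<^sub>R fact j) \<longlonglongrightarrow> exp (- \<mu>)"
      using exp_converges[of "- \<mu>"] by (simp add: sums_def)
    ultimately have "a \<longlonglongrightarrow> \<mu> ^ k / fact k * exp (- \<mu>)"
      by (simp only:) (intro tendsto_mult tendsto_const)
    thus ?thesis by (simp add: mult.commute)
  qed
  have bound: "\<bar>measure_pmf.prob (M n) {\<omega>. S n \<omega> = k} - (\<Sum>j<L. (-1) ^ j * real (k + j choose k) * e n (k + j))\<bar>
      \<le> real (k + L choose k) * e n (k + L)" for n L
  proof -
    have ind: "integrable (measure_pmf (M n)) (\<lambda>\<omega>. of_bool (S n \<omega> = k) :: real)"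
      by (rule measure_pmf.integrable_const_bound[where B = 1]) auto
    have diff_int: "integrable (measure_pmf (M n)) (\<lambda>\<omega>. of_bool (S n \<omega> = k) -
           (\<Sum>j<L. (-1) ^ j * real (k + j choose k) * real (S n \<omega> choose (k + j))))"
      by (rule Bochner_Integration.integrable_diff[OF ind Bochner_Integration.integrable_sum])
         (rule integrable_mult_right[OF int])
    have of_bool_indicator: "(\<lambda>\<omega>. of_bool (S n \<omega> = k) :: real) = indicator {\<omega>. S n \<omega> = k}"
      by (rule ext) (simp add: indicator_def)
    have "measure_pmf.prob (M n) {\<omega>. S n \<omega> = k} = measure_pmf.expectation (M n) (\<lambda>\<omega>. of_bool (S n \<omega> = k))"
      unfolding of_bool_indicator by simp
    hence "\<bar>measure_pmf.prob (M n) {\<omega>. S n \<omega> = k} - (\<Sum>j<L. (-1) ^ j * real (k + j choose k) * e n (k + j))\<bar> =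
       \<bar>measure_pmf.expectation (M n) (\<lambda>\<omega>. of_bool (S n \<omega> = k) -
           (\<Sum>j<L. (-1) ^ j * real (k + j choose k) * real (S n \<omega> choose (k + j))))\<bar>"
      by (simp add: int ind e_def)
    also have "\<dots> \<le> measure_pmf.expectation (M n) (\<lambda>\<omega>. \<bar>of_bool (S n \<omega> = k) -
           (\<Sum>j<L. (-1) ^ j * real (k + j choose k) * real (S n \<omega> choose (k + j)))\<bar>)"
      by (rule integral_abs_bound)
    also have "\<dots> \<le> measure_pmf.expectation (M n) (\<lambda>\<omega>. real (k + L choose k) * real (S n \<omega> choose (k + L)))"
      using integrable_abs[OF diff_int] integrable_mult_right[OF int] inclusion_exclusion_error
      by (rule integral_mono)
    also have "\<dots> = real (k + L choose k) * e n (k + L)"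
      by (simp add: e_def)
    finally show ?thesis .
  qed
  show ?thesis
  proof (rule tendstoI)
    fix \<epsilon> :: real assume "\<epsilon> > 0"
    \<comment> \<open>A quarter each goes to the distance of \<open>a L\<close> from its limit, to
      \<open>b L\<close>, and to the two limits in \<open>n\<close>.\<close>
    hence \<epsilon>: "\<epsilon> / 4 > 0" by simp
    have "\<forall>\<^sub>F L in sequentially. dist (a L) (exp (- \<mu>) * \<mu> ^ k / fact k) < \<epsilon> / 4 \<and> dist (b L) 0 < \<epsilon> / 4"
      using tendstoD[OF a_lim \<epsilon>] tendstoD[OF b_lim \<epsilon>] by (rule eventually_conj)
    then obtain L where L: "dist (a L) (exp (- \<mu>) * \<mu> ^ k / fact k) < \<epsilon> / 4" "dist (b L) 0 < \<epsilon> / 4"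
      by (auto simp: eventually_sequentially)
    have lim: "(\<lambda>n. \<Sum>j<L. (-1) ^ j * real (k + j choose k) * e n (k + j)) \<longlonglongrightarrow> a L"
              "(\<lambda>n. real (k + L choose k) * e n (k + L)) \<longlonglongrightarrow> b L"
      unfolding a_def b_def e_def by (intro tendsto_intros mom)+
    from tendstoD[OF lim(1) \<epsilon>] tendstoD[OF lim(2) \<epsilon>]
    show "\<forall>\<^sub>F n in sequentially. dist (measure_pmf.prob (M n) {\<omega>. S n \<omega> = k}) (exp (- \<mu>) * \<mu> ^ k / fact k) < \<epsilon>"
    proof eventually_elim
      case (elim n)
      thus ?case using bound[of n L] L unfolding dist_real_def by linarith
    qed
  qed
qed

lemma choose_over_power_tendsto:
  "(\<lambda>n. real (n choose m) / real n ^ m) \<longlonglongrightarrow> 1 / fact m"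
proof -
  have "(\<lambda>n. \<Prod>i<m. ((real n - real i) / real n) / real (m - i)) \<longlonglongrightarrow> (\<Prod>i<m. 1 / real (m - i))"
  proof (intro tendsto_prod tendsto_divide tendsto_const)
    show "(\<lambda>n. (real n - real i) / real n) \<longlonglongrightarrow> 1" for i
      by real_asymp
  qed auto
  also have "(\<Prod>i<m. 1 / real (m - i)) = 1 / fact m"
    by (simp add: fact_prod_rev prod_dividef atLeast0LessThan)
  finally show ?thesis
  proof (rule Lim_transform_eventually)
    show "\<forall>\<^sub>F n in sequentially. (\<Prod>i<m. ((real n - real i) / real n) / real (m - i)) = real (n choose m) / real n ^ m"
      using eventually_ge_at_top[of m]
    proof eventually_elim
      case (elim n)
      thus ?case
        by (simp add: binomial_altdef_of_nat prod_dividef prod.distrib atLeast0LessThan mult.commute)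
    qed
  qed
qed

section \<open>Independence in product distributions\<close>

lemma prob_pair_pmf_Times:
  "measure_pmf.prob (pair_pmf M N) (A \<times> B) = measure_pmf.prob M A * measure_pmf.prob N B"
proof -
  have "measure_pmf.prob (map_pmf (Pair x) N) (A \<times> B) = indicator A x * measure_pmf.prob N B" for x
    by (cases "x \<in> A") (auto simp: measure_map_pmf vimage_def)
  thus ?thesis
    by (simp add: pair_pmf_def map_pmf_def[symmetric] prob_bind_pmf)
qed

text \<open>The product law splits into independent parts on \<open>A\<close> and on
  \<open>I - A\<close>. As \<open>R\<close> reads only \<open>B\<close>, inside the second part, the
  joint event becomes a rectangle.\<close>

lemma prob_Pi_pmf_conj:
  assumes I: "finite I" "A \<subseteq> I" "B \<subseteq> I" "A \<inter> B = {}"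
    and Q: "\<And>f g. (\<And>x. x \<in> A \<Longrightarrow> f x = g x) \<Longrightarrow> Q f \<longleftrightarrow> Q g"
    and R: "\<And>f g. (\<And>x. x \<in> B \<Longrightarrow> f x = g x) \<Longrightarrow> R f \<longleftrightarrow> R g"
  shows "measure_pmf.prob (Pi_pmf I d P) {f. Q f \<and> R f} =
           measure_pmf.prob (Pi_pmf I d P) {f. Q f} * measure_pmf.prob (Pi_pmf I d P) {f. R f}"
proof -
  let ?PA = "Pi_pmf A d P" and ?PB = "Pi_pmf (I - A) d P"
  have fin: "finite A" "finite (I - A)" using I finite_subset by auto
  have I_eq: "Pi_pmf I d P = map_pmf (\<lambda>(f, g) x. if x \<in> A then f x else g x) (pair_pmf ?PA ?PB)"
    using Pi_pmf_union[OF fin, of d P] I(2) by (simp add: Un_absorb1)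
  have "Q (\<lambda>x. if x \<in> A then f x else g x) \<longleftrightarrow> Q f" for f g
    by (rule Q) auto
  moreover have "R (\<lambda>x. if x \<in> A then f x else g x) \<longleftrightarrow> R g" for f g
    by (rule R) (use I(4) in auto)
  ultimately have pre:
    "(\<lambda>(f, g) x. if x \<in> A then f x else g x) -` {f. Q f \<and> R f} = {f. Q f} \<times> {g. R g}"
    "(\<lambda>(f, g) x. if x \<in> A then f x else g x) -` {f. Q f} = {f. Q f} \<times> UNIV"
    "(\<lambda>(f, g) x. if x \<in> A then f x else g x) -` {f. R f} = UNIV \<times> {g. R g}"
    by auto
  show ?thesis
    unfolding I_eq measure_map_pmf pre prob_pair_pmf_Times by simp
qed

lemma prob_Pi_pmf_Ball:
  assumes "finite J" "finite I" "\<And>j. j \<in> J \<Longrightarrow> K j \<subseteq> I" "disjoint_family_on K J"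
    and "\<And>j f g. j \<in> J \<Longrightarrow> (\<And>x. x \<in> K j \<Longrightarrow> f x = g x) \<Longrightarrow> Q j f \<longleftrightarrow> Q j g"
  shows "measure_pmf.prob (Pi_pmf I d P) {f. \<forall>j\<in>J. Q j f} = (\<Prod>j\<in>J. measure_pmf.prob (Pi_pmf I d P) {f. Q j f})"
  using assms(1,3-)
proof (induction J rule: finite_induct)
  case (insert j J)
  have "measure_pmf.prob (Pi_pmf I d P) {f. Q j f \<and> (\<forall>i\<in>J. Q i f)} =
          measure_pmf.prob (Pi_pmf I d P) {f. Q j f} * measure_pmf.prob (Pi_pmf I d P) {f. \<forall>i\<in>J. Q i f}"
  proof (rule prob_Pi_pmf_conj[where A = "K j" and B = "\<Union>i\<in>J. K i"])
    show "K j \<inter> (\<Union>i\<in>J. K i) = {}"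
      using insert.prems(2) insert.hyps by (auto simp: disjoint_family_on_def)
    show "(\<forall>i\<in>J. Q i f) \<longleftrightarrow> (\<forall>i\<in>J. Q i g)" if "\<And>x. x \<in> (\<Union>i\<in>J. K i) \<Longrightarrow> f x = g x" for f g
      by (intro ball_cong refl insert.prems(3)) (use that in auto)
    show "Q j f \<longleftrightarrow> Q j g" if "\<And>x. x \<in> K j \<Longrightarrow> f x = g x" for f g
      by (rule insert.prems(3)) (use that in auto)
    show "finite I" "K j \<subseteq> I" "(\<Union>i\<in>J. K i) \<subseteq> I"
      using assms(2) insert.prems(1) by auto
  qed
  moreover have "measure_pmf.prob (Pi_pmf I d P) {f. \<forall>j\<in>J. Q j f} = (\<Prod>j\<in>J. measure_pmf.prob (Pi_pmf I d P) {f. Q j f})"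
  proof (rule insert.IH)
    show "disjoint_family_on K J"
      using insert.prems(2) by (rule disjoint_family_on_mono[rotated]) auto
    show "Q i f \<longleftrightarrow> Q i g" if "i \<in> J" "\<And>x. x \<in> K i \<Longrightarrow> f x = g x" for i f g
      by (rule insert.prems(3)) (use that in auto)
  qed (use insert.prems(1) in auto)
  ultimately show ?case
    using insert.hyps by simp
qed simp

text \<open>Injectivity of \<open>e\<close> makes the summands independent, and \<open>h j\<close>
  may reverse the viewpoint of a game because it preserves the law. The induction removes the
  coordinate \<open>e a\<close>, so \<open>E\<close> has to vary.\<close>

lemma game_sum_eq_sum_Pi_pmf:
  assumes "finite A" "finite E" "inj_on e A" "e ` A \<subseteq> E"
    and "\<And>j. j \<in> A \<Longrightarrow> map_pmf (h j) (game_pmf p) = game_pmf p"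
  shows "map_pmf (\<lambda>\<omega>. \<Sum>j\<in>A. h j (\<omega> (e j))) (Pi_pmf E d (\<lambda>_. game_pmf p)) = game_sum p (card A)"
  using assms
proof (induction A arbitrary: E rule: finite_induct)
  case (insert a A)
  define E' where "E' = E - {e a}"
  have E: "E = insert (e a) E'" "e a \<notin> E'" "finite E'"
    using insert.prems(1,3) by (auto simp: E'_def)
  have e_ne: "e j \<noteq> e a" if "j \<in> A" for j
    using insert.prems(2) insert.hyps that by (auto simp: inj_on_def)
  have IH: "map_pmf (\<lambda>\<omega>. \<Sum>j\<in>A. h j (\<omega> (e j))) (Pi_pmf E' d (\<lambda>_. game_pmf p)) = game_sum p (card A)"
  proof (rule insert.IH)
    show "inj_on e A" using insert.prems(2) by (rule inj_on_subset) auto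
    show "e ` A \<subseteq> E'" using insert.prems(3) e_ne by (auto simp: E'_def)
    show "map_pmf (h j) (game_pmf p) = game_pmf p" if "j \<in> A" for j
      using that by (intro insert.prems(4)) auto
  qed (fact E(3))
  have upd: "(\<Sum>j\<in>insert a A. h j ((f(e a := y)) (e j))) = h a y + (\<Sum>j\<in>A. h j (f (e j)))" for f y
    using insert.hyps e_ne by (auto intro!: sum.cong)
  have "map_pmf (\<lambda>\<omega>. \<Sum>j\<in>insert a A. h j (\<omega> (e j))) (Pi_pmf E d (\<lambda>_. game_pmf p)) =
     bind_pmf (game_pmf p) (\<lambda>y. bind_pmf (Pi_pmf E' d (\<lambda>_. game_pmf p))
         (\<lambda>f. return_pmf (h a y + (\<Sum>j\<in>A. h j (f (e j))))))"
    unfolding E(1) Pi_pmf_insert'[OF E(3,2)] map_bind_pmf map_return_pmf upd ..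
  also have "\<dots> = bind_pmf (game_pmf p) (\<lambda>y. map_pmf ((+) (h a y)) (game_sum p (card A)))"
    unfolding IH[symmetric] pmf.map_comp o_def map_pmf_def[symmetric] ..
  also have "\<dots> = bind_pmf (map_pmf (h a) (game_pmf p)) (\<lambda>y. map_pmf ((+) y) (game_sum p (card A)))"
    by (simp add: bind_map_pmf)
  also have "\<dots> = game_sum p (card (insert a A))"
    by (subst insert.prems(4)) (use insert.hyps in auto)
  finally show ?case .
qed (simp add: map_pmf_const)

section \<open>Joint exceedances in the tournament\<close>

lemma finite_pairs [simp]: "finite (pairs n)"
  by (rule finite_subset[of _ "{1..n} \<times> {1..n}"]) (auto simp: pairs_def)

lemma finite_set_tournament [simp]: "finite (set_pmf (tournament n p))"
proof -
  have "finite (set_pmf (game_pmf p))"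
    by (simp add: game_pmf_def)
  thus ?thesis
    unfolding tournament_def
    by (intro finite_subset[OF set_Pi_pmf_subset'] finite_PiE_dflt) auto
qed

definition game_index :: "nat \<Rightarrow> nat \<Rightarrow> nat \<times> nat" where
  "game_index i j = (if i < j then (i, j) else (j, i))"

definition outer_score :: "nat \<Rightarrow> nat set \<Rightarrow> (nat \<times> nat \<Rightarrow> real) \<Rightarrow> nat \<Rightarrow> real" where
  "outer_score n J \<omega> i = (\<Sum>j\<in>{1..n} - J. X \<omega> i j)"

lemma X_eq: "X \<omega> i j = (if i < j then (\<lambda>x. x) else (\<lambda>x. 1 - x)) (\<omega> (game_index i j))"
  by (simp add: X_def game_index_def)

lemma game_index_in_pairs: "i \<in> {1..n} \<Longrightarrow> j \<in> {1..n} \<Longrightarrow> i \<noteq> j \<Longrightarrow> game_index i j \<in> pairs n"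
  by (auto simp: game_index_def pairs_def)

lemma outer_score_distribution:
  assumes "i \<in> J" "J \<subseteq> {1..n}"
  shows "map_pmf (\<lambda>\<omega>. outer_score n J \<omega> i) (tournament n p) = game_sum p (n - card J)"
proof -
  have "card ({1..n} - J) = n - card J"
    using assms by (subst card_Diff_subset) (auto intro: finite_subset)
  moreover have "map_pmf (\<lambda>\<omega>. outer_score n J \<omega> i) (tournament n p) = game_sum p (card ({1..n} - J))"
    unfolding outer_score_def X_eq tournament_def
  proof (rule game_sum_eq_sum_Pi_pmf)
    show "inj_on (game_index i) ({1..n} - J)"
      by (auto simp: inj_on_def game_index_def split: if_splits)
    show "game_index i ` ({1..n} - J) \<subseteq> pairs n"
      by (intro image_subsetI game_index_in_pairs) (use assms in auto)
  qed (auto simp: game_pmf_reflect map_pmf_ident)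
  ultimately show ?thesis by simp
qed

text \<open>A game with exactly one participant in \<open>J\<close> determines that participant, so
  distinct players of \<open>J\<close> use disjoint index sets and their outer scores are
  independent with a common law.\<close>

lemma prob_outer_scores_greater:
  assumes J: "J \<subseteq> {1..n}"
  shows "measure_pmf.prob (tournament n p) {\<omega>. \<forall>i\<in>J. outer_score n J \<omega> i > c} =
           measure_pmf.prob (game_sum p (n - card J)) {s. s > c} ^ card J"
proof -
  have "measure_pmf.prob (tournament n p) {\<omega>. \<forall>i\<in>J. outer_score n J \<omega> i > c} =
          (\<Prod>i\<in>J. measure_pmf.prob (tournament n p) {\<omega>. outer_score n J \<omega> i > c})"
    unfolding tournament_def
  proof (rule prob_Pi_pmf_Ball[where K = "\<lambda>i. game_index i ` ({1..n} - J)"])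
    show "disjoint_family_on (\<lambda>i. game_index i ` ({1..n} - J)) J"
      by (auto simp: disjoint_family_on_def game_index_def split: if_splits)
    show "game_index i ` ({1..n} - J) \<subseteq> pairs n" if "i \<in> J" for i
      by (intro image_subsetI game_index_in_pairs) (use that J in auto)
    show "outer_score n J f i > c \<longleftrightarrow> outer_score n J g i > c"
      if "\<And>x. x \<in> game_index i ` ({1..n} - J) \<Longrightarrow> f x = g x" for i f g
    proof -
      have "outer_score n J f i = outer_score n J g i"
        unfolding outer_score_def X_eq by (intro sum.cong refl) (simp add: that)
      thus ?thesis by simp
    qed
  qed (use J in \<open>auto intro: finite_subset\<close>)
  also have "\<dots> = (\<Prod>i\<in>J. measure_pmf.prob (game_sum p (n - card J)) {s. s > c})"
  proof (intro prod.cong refl)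
    fix i assume "i \<in> J"
    thus "measure_pmf.prob (tournament n p) {\<omega>. outer_score n J \<omega> i > c} =
            measure_pmf.prob (game_sum p (n - card J)) {s. s > c}"
      unfolding outer_score_distribution[OF \<open>i \<in> J\<close> J, symmetric] measure_map_pmf by (simp add: vimage_def)
  qed
  finally show ?thesis by simp
qed

text \<open>The two scores differ by the games inside \<open>J\<close>, each worth between 0 and 1.
  Membership of \<open>\<omega>\<close> in the support supplies these bounds.\<close>

lemma score_bounds:
  assumes \<omega>: "\<omega> \<in> set_pmf (tournament n p)" and J: "i \<in> J" "J \<subseteq> {1..n}"
  shows "outer_score n J \<omega> i \<le> score n \<omega> i" "score n \<omega> i \<le> outer_score n J \<omega> i + real (card J)"
proof -
  have fin: "finite J" using J finite_subset by auto
  have "\<omega> \<in> PiE_dflt (pairs n) 0 (set_pmf \<circ> (\<lambda>_. game_pmf p))"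
    by (rule subsetD[OF set_Pi_pmf_subset'[OF finite_pairs] \<omega>[unfolded tournament_def]])
  hence "\<omega> e \<in> set_pmf (game_pmf p)" if "e \<in> pairs n" for e
    using that unfolding PiE_dflt_def o_def by blast
  hence pair01: "\<omega> e \<in> {0..1}" if "e \<in> pairs n" for e
    using that set_game_pmf by blast
  have X01: "X \<omega> i j \<in> {0..1}" if "j \<in> J - {i}" for j
  proof -
    have "game_index i j \<in> pairs n"
      by (rule game_index_in_pairs) (use that J in auto)
    from pair01[OF this] show ?thesis by (simp add: X_eq)
  qed
  have "{1..n} - {i} = ({1..n} - J) \<union> (J - {i})" using J by auto
  hence split: "score n \<omega> i = outer_score n J \<omega> i + (\<Sum>j\<in>J - {i}. X \<omega> i j)"
    unfolding score_def outer_score_def by (simp only:) (rule sum.union_disjoint, use fin in auto)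
  have "(\<Sum>j\<in>J - {i}. X \<omega> i j) \<ge> 0"
    using X01 by (intro sum_nonneg) auto
  thus "outer_score n J \<omega> i \<le> score n \<omega> i" by (simp add: split)
  have "(\<Sum>j\<in>J - {i}. X \<omega> i j) \<le> real (card (J - {i})) * 1"
    using X01 by (intro sum_bounded_above) auto
  also have "\<dots> \<le> real (card J)"
    using fin by (simp add: card_mono)
  finally show "score n \<omega> i \<le> outer_score n J \<omega> i + real (card J)" by (simp add: split)
qed

text \<open>Against the opponents outside \<open>J\<close> the players of \<open>J\<close> play disjoint sets of games,
  and the games inside \<open>J\<close> shift each score by at most \<open>card J\<close>.\<close>
lemma prob_all_exceed_bounds:
  fixes t :: real
  assumes J: "J \<subseteq> {1..n}" and "n > 1" "p < 1"
  defines "q \<equiv> \<lambda>c. measure_pmf.prob (game_sum p (n - card J)) {s. s > (real n - 1) / 2 + x_n n t * sigma_n n p + c}"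
    and "P \<equiv> measure_pmf.prob (tournament n p) {\<omega>. \<forall>i\<in>J. norm_score n p \<omega> i > x_n n t}"
  shows "q 0 ^ card J \<le> P" "P \<le> q (- real (card J)) ^ card J"
proof -
  define T where "T = (real n - 1) / 2 + x_n n t * sigma_n n p"
  have "sigma_n n p > 0" using assms by (simp add: sigma_n_def)
  hence exceed: "norm_score n p \<omega> i > x_n n t \<longleftrightarrow> score n \<omega> i > T" for \<omega> i
    by (auto simp: norm_score_def T_def field_simps)
  have "q 0 ^ card J = measure_pmf.prob (tournament n p) {\<omega>. \<forall>i\<in>J. outer_score n J \<omega> i > T}"
    by (simp add: q_def prob_outer_scores_greater[OF J] T_def)
  also have "\<dots> \<le> P"
    unfolding P_def exceed
    by (rule measure_pmf.finite_measure_mono_AE)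
       (use score_bounds(1)[OF _ _ J] in \<open>fastforce simp: AE_measure_pmf_iff\<close>, simp)
  finally show "q 0 ^ card J \<le> P" .
  have "P \<le> measure_pmf.prob (tournament n p) {\<omega>. \<forall>i\<in>J. outer_score n J \<omega> i > T - real (card J)}"
    unfolding P_def exceed
    by (rule measure_pmf.finite_measure_mono_AE)
       (use score_bounds(2)[OF _ _ J] in \<open>fastforce simp: AE_measure_pmf_iff\<close>, simp)
  also have "\<dots> = q (- real (card J)) ^ card J"
    by (simp add: q_def prob_outer_scores_greater[OF J] T_def)
  finally show "P \<le> q (- real (card J)) ^ card J" .
qed

section \<open>Binomial moments of the number of exceedances\<close>

lemma expectation_S_n_choose:
  "measure_pmf.expectation (tournament n p) (\<lambda>\<omega>. real (S_n n p t \<omega> choose m)) =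
     (\<Sum>J | J \<subseteq> {1..n} \<and> card J = m. measure_pmf.prob (tournament n p) {\<omega>. \<forall>i\<in>J. norm_score n p \<omega> i > x_n n t})"
proof -
  let ?E = "\<lambda>J. {\<omega>. \<forall>i\<in>J. norm_score n p \<omega> i > x_n n t}"
  have fin: "finite {J. J \<subseteq> {1..n} \<and> card J = m}"
    by (rule finite_subset[of _ "Pow {1..n}"]) auto
  \<comment> \<open>The binomial coefficient counts the \<open>m\<close>-sets of players who all
    exceed the threshold; linearity of expectation then finishes.\<close>
  have "real (S_n n p t \<omega> choose m) = (\<Sum>J | J \<subseteq> {1..n} \<and> card J = m. indicator (?E J) \<omega>)" for \<omega>
  proof -
    let ?A = "{j\<in>{1..n}. norm_score n p \<omega> j > x_n n t}"
    have "S_n n p t \<omega> choose m = card {J. J \<subseteq> ?A \<and> card J = m}"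
      unfolding S_n_def by (rule n_subsets[symmetric]) auto
    also have "{J. J \<subseteq> ?A \<and> card J = m} = {J \<in> {J. J \<subseteq> {1..n} \<and> card J = m}. \<omega> \<in> ?E J}"
      by auto
    also have "real (card \<dots>) = (\<Sum>J | J \<subseteq> {1..n} \<and> card J = m. indicator (?E J) \<omega>)"
      using fin by (simp add: indicator_def sum.If_cases Int_def)
    finally show ?thesis .
  qed
  thus ?thesis
    by (simp add: Bochner_Integration.integral_sum measure_pmf.emeasure_eq_measure)
qed

text \<open>All \<open>n choose m\<close> sets share the same two bounds, with shifts
  \<open>0\<close> and \<open>- m\<close>. For either shift \<open>(n * q) ^ m\<close> tends to
  \<open>exp (- t) ^ m\<close>, while \<open>(n choose m) / n ^ m\<close> tends to
  \<open>1 / m!\<close>.\<close>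

lemma binomial_moments_tendsto:
  assumes p: "0 \<le> p" "p < 1"
  shows "(\<lambda>n. measure_pmf.expectation (tournament n p) (\<lambda>\<omega>. real (S_n n p t \<omega> choose m)))
           \<longlonglongrightarrow> exp (- t) ^ m / fact m"
proof -
  define q where "q = (\<lambda>c n. measure_pmf.prob (game_sum p (n - m)) {s. s > (real n - 1) / 2 + x_n n t * sigma_n n p + c})"
  have lim: "(\<lambda>n. real (n choose m) * q c n ^ m) \<longlonglongrightarrow> exp (- t) ^ m / fact m" for c
  proof -
    have "(\<lambda>n. (real (n choose m) / real n ^ m) * (real n * q c n) ^ m) \<longlonglongrightarrow> (1 / fact m) * exp (- t) ^ m"
      unfolding q_def by (intro tendsto_mult choose_over_power_tendsto tendsto_power game_sum_tail_x_n p)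
    hence "(\<lambda>n. (real (n choose m) / real n ^ m) * (real n * q c n) ^ m) \<longlonglongrightarrow> exp (- t) ^ m / fact m"
      by simp
    thus ?thesis
    proof (rule Lim_transform_eventually)
      show "\<forall>\<^sub>F n in sequentially. (real (n choose m) / real n ^ m) * (real n * q c n) ^ m = real (n choose m) * q c n ^ m"
        using eventually_gt_at_top[of 0] by eventually_elim (simp add: power_mult_distrib)
    qed
  qed
  have card: "card {J. J \<subseteq> {1..n} \<and> card J = m} = n choose m" for n :: nat
    using n_subsets[of "{1..n}" m] by simp
  show ?thesis
  proof (rule tendsto_sandwich)
    show "\<forall>\<^sub>F n in sequentially. real (n choose m) * q 0 n ^ m \<le> measure_pmf.expectation (tournament n p) (\<lambda>\<omega>. real (S_n n p t \<omega> choose m))"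
      using eventually_gt_at_top[of 1]
    proof eventually_elim
      case (elim n)
      show ?case
        unfolding expectation_S_n_choose card[of n, symmetric]
        by (rule sum_bounded_below) (use prob_all_exceed_bounds(1)[OF _ elim p(2)] in \<open>auto simp: q_def\<close>)
    qed
    show "\<forall>\<^sub>F n in sequentially. measure_pmf.expectation (tournament n p) (\<lambda>\<omega>. real (S_n n p t \<omega> choose m)) \<le> real (n choose m) * q (- real m) n ^ m"
      using eventually_gt_at_top[of 1]
    proof eventually_elim
      case (elim n)
      show ?case
        unfolding expectation_S_n_choose card[of n, symmetric]
        by (rule sum_bounded_above) (use prob_all_exceed_bounds(2)[OF _ elim p(2)] in \<open>auto simp: q_def\<close>)
    qed
  qed (rule lim)+
qed

theorem theorem1:
  fixes p t :: real and k :: nat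
  assumes "p = 0 \<or> (1/3 \<le> p \<and> p < 1)"
  shows "(\<lambda>n. measure_pmf.prob (tournament n p) {\<omega>. S_n n p t \<omega> = k})
           \<longlonglongrightarrow> exp (- exp (- t)) * exp (- t) ^ k / fact k"
proof (rule poisson_limit_of_binomial_moments)
  have "0 \<le> p" "p < 1" using assms by auto
  thus "(\<lambda>n. measure_pmf.expectation (tournament n p) (\<lambda>\<omega>. real (S_n n p t \<omega> choose m)))
           \<longlonglongrightarrow> exp (- t) ^ m / fact m" for m
    by (rule binomial_moments_tendsto)
\<comment> \<open>The tournament has finitely many outcomes, so every binomial moment is
  integrable.\<close>
qed (rule integrable_measure_pmf_finite, simp)

end
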